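(* Let $n\in\mathbb N$ (positive integer), let $f\in C(T)$, and let $h>\frac1{2n}$. Then $$E_n(f):=\inf_{\tau\in T_{2n-1}}\|f-\tau\|\le(1-c(h,n))^{-1}\,W_2(f,h).$$
   Context: All functions are real-valued; $T=\mathbb R/\mathbb Z$, so functions on $T$ are 1-periodic functions on $\mathbb R$, and $C(T)$ is the space of continuous functions on $T$. $T_{2n-1}$ is the space of 1-periodic real trigonometric polynomials of degree $\le n-1$, i.e. functions $\sum_{j=0}^{n-1}a_j\cos(2\pi jx)+\sum_{j=1}^{n-1}b_j\sin(2\pi jx)$ with real coefficients. $T_{2n-1}^\perp$ is the space of all $g\in L_\infty(T)$ with $\int_{-1/2}^{1/2}g(t)\tau(t)\,dt=0$ for every $\tau\in T_{2n-1}$. $\|\cdot\|$ is the (essential) supremum norm. For $h>0$, $\chi_h$ is the characteristic function of $(-h/2,h/2)$ multiplied by $1/h$, and $(f*\chi_h)(x)=\int_{\mathbb R}f(t)\chi_h(x-t)\,dt=\frac1h\int_{x-h/2}^{x+h/2}f(t)\,dt$. The constant $c(h,n)$ is $$c(h,n):=\sup_{g\in T_{2n-1}^\perp,\ g\ne0}\frac{\|g*\chi_h\|}{\|g\|};$$ it is known that $c(h,n)\le\frac1{2nh}<1$ for $h>\frac1{2n}$. It also equals $\inf_{\tau\in T_{2n-1}}\int_T|\widetilde\chi_h(t)-\tau(t)|\,dt$, where $\widetilde\chi_h(x)=\sum_{j\in\mathbb Z}\chi_h(x+j)$. Finally $$W_2(f,h):=\sup_x|f(x)-(f*\chi_h)(x)|.$$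 *)

theory Defs
  imports
    "HOL-Analysis.Analysis"
    "HOL-Library.Periodic_Fun"
    "HOL-Probability.Essential_Supremum"
begin

text \<open>
  Functions on the circle \<open>T = \<real>/\<int>\<close> are 1-periodic functions on \<open>\<real>\<close>; the locale
  \<open>periodic_fun_simple'\<close> says \<open>f (x + 1) = f x\<close> for all \<open>x\<close>.
\<close>

definition C_T :: "(real \<Rightarrow> real) set" where
  "C_T = {f. periodic_fun_simple' f \<and> continuous_on UNIV f}"

text \<open>
  For 1-periodic functions the essential supremum over \<open>\<real>\<close> equals that over one period.
  On \<open>Linf_T\<close>, which contains \<open>C_T\<close>, it is finite, so the conversion to \<open>real\<close> is harmless.
\<close>

definition Linf_norm :: "(real \<Rightarrow> real) \<Rightarrow> real" where
  "Linf_norm g = real_of_ereal (esssup lebesgue (\<lambda>x. ereal \<bar>g x\<bar>))"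

definition Linf_T :: "(real \<Rightarrow> real) set" where
  "Linf_T = {g. periodic_fun_simple' g \<and> g \<in> borel_measurable lebesgue \<and>
               esssup lebesgue (\<lambda>x. ereal \<bar>g x\<bar>) < \<infinity>}"

text \<open>
  \<open>trig_poly n\<close> is the space \<open>T\<^bsub>2n-1\<^esub>\<close> of trigonometric polynomials of degree at most \<open>n - 1\<close>;
  the argument is \<open>n\<close>, not the dimension.
\<close>

definition trig_poly :: "nat \<Rightarrow> (real \<Rightarrow> real) set" where
  "trig_poly n = {\<tau>. \<exists>a b :: nat \<Rightarrow> real. \<tau> =
     (\<lambda>x. (\<Sum>j<n. a j * cos (2 * pi * real j * x)) +
          (\<Sum>j\<in>{1..<n}. b j * sin (2 * pi * real j * x)))}"

definition trig_poly_perp :: "nat \<Rightarrow> (real \<Rightarrow> real) set" where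
  "trig_poly_perp n = {g \<in> Linf_T. \<forall>\<tau>\<in>trig_poly n.
     (LINT t:{-1/2..1/2}|lebesgue. g t * \<tau> t) = 0}"

definition convol :: "(real \<Rightarrow> real) \<Rightarrow> (real \<Rightarrow> real) \<Rightarrow> real \<Rightarrow> real" where
  "convol f k x = (LINT t|lebesgue. f t * k (x - t))"

definition chi :: "real \<Rightarrow> real \<Rightarrow> real" where
  "chi h x = indicator {-h/2<..<h/2} x / h"

text \<open>
  The condition \<open>g \<noteq> 0\<close> is meant in \<open>L\<^sub>\<infinity>\<close>, i.e. \<open>g\<close> does not vanish almost everywhere.
  For \<open>h > 0\<close> and \<open>n \<ge> 1\<close> the set of quotients is nonempty (take \<open>g x = cos (2 \<pi> n x)\<close>)
  and bounded by 1, so the real-valued supremum is the true one.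
\<close>

definition c_const :: "real \<Rightarrow> nat \<Rightarrow> real" where
  "c_const h n =
     (SUP g\<in>{g \<in> trig_poly_perp n. \<not> (AE x in lebesgue. g x = 0)}.
        Linf_norm (convol g (chi h)) / Linf_norm g)"

definition W2 :: "(real \<Rightarrow> real) \<Rightarrow> real \<Rightarrow> real" where
  "W2 f h = (SUP x. \<bar>f x - convol f (chi h) x\<bar>)"

definition best_approx :: "nat \<Rightarrow> (real \<Rightarrow> real) \<Rightarrow> real" where
  "best_approx n f = (INF \<tau>\<in>trig_poly n. Linf_norm (\<lambda>x. f x - \<tau> x))"

end

theory Submission
  imports Defs
begin

text \<open>
  Let \<open>E = best_approx n f\<close>, \<open>c = c_const h n\<close>, and let \<open>w\<close> be the 1-periodization of \<open>\<chi>\<^sub>h\<close>, so that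
  convolution of a periodic function with \<open>\<chi>\<^sub>h\<close> is periodic convolution with \<open>w\<close>. For trigonometric polynomials
  \<open>\<tau>\<close> and \<open>\<tau>0\<close> of degree at most \<open>n - 1\<close>,
  \<open>f * \<chi>\<^sub>h = \<tau> * w + (f - \<tau>) * \<tau>0 + (f - \<tau>) * (w - \<tau>0)\<close>.
  The first two terms on the right are again trigonometric polynomials of degree at most \<open>n - 1\<close>, and the last
  one is bounded by \<open>\<parallel>f - \<tau>\<parallel>\<close> times the \<open>L\<^sub>1\<close> norm of \<open>w - \<tau>0\<close>. As \<open>f\<close> differs from \<open>f * \<chi>\<^sub>h\<close> by at
  most \<open>W2 f h\<close>, this gives \<open>E \<le> W2 f h + \<parallel>w - \<tau>0\<parallel>\<^sub>1 \<parallel>f - \<tau>\<parallel>\<close> (\<open>best_approx_recursive_bound\<close>). Passing to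
  the infimum over \<open>\<tau>\<close>, and choosing \<open>\<tau>0\<close> with \<open>\<parallel>w - \<tau>0\<parallel>\<^sub>1\<close> close to \<open>c\<close>, yields \<open>E \<le> W2 f h + c E\<close>, and
  the theorem follows because \<open>c < 1\<close>.

  Two facts about \<open>c\<close> carry this argument. The first is that the \<open>L\<^sub>1\<close> distance from \<open>w\<close> to the trigonometric polynomials is
  at most \<open>c\<close>. This is a duality statement. It is proved in
  \<open>L1_distance_le_dual_bound\<close> by smoothing the \<open>L\<^sub>1\<close> norm and using the derivative at a near-minimizer as
  extremal functional, after a correction by its orthogonal projection.

  The second is \<open>c < 1\<close>, proved in \<open>convol_chi_strict_contraction\<close>. A
  bounded function that annihilates the trigonometric polynomials cannot have a mean close to its
  norm on an interval of length \<open>h > 1 / (2 n)\<close>: it would have a nonzero pairing with a translate of an explicit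
  polynomial, a sum of two Dirichlet kernels, that has more than half of its \<open>L\<^sub>1\<close> mass on that interval.
\<close>

section \<open>Translation invariance of Lebesgue measure\<close>

lemma distr_lebesgue_shift: "distr lebesgue lebesgue (\<lambda>x. a + x) = (lebesgue :: real measure)"
  using lebesgue_real_affine[of 1 a] by (simp add: density_1)

lemma measurable_lebesgue_shift: "(\<lambda>x::real. a + x) \<in> lebesgue \<rightarrow>\<^sub>M lebesgue"
  using lebesgue_affine_measurable[of "\<lambda>_. 1::real" a] by simp

lemma borel_measurable_lebesgue_shift:
  assumes "g \<in> borel_measurable (lebesgue :: real measure)"
  shows "(\<lambda>x. g (a + x)) \<in> borel_measurable lebesgue"
  using measurable_compose[OF measurable_lebesgue_shift assms] .

lemma borel_imp_lebesgue_measurable: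
  "g \<in> borel_measurable borel \<Longrightarrow> g \<in> borel_measurable (lebesgue :: real measure)"
  by (simp add: measurable_completion)

lemma AE_lebesgue_shift:
  assumes "AE x in lebesgue. P (x::real)"
  shows "AE x in lebesgue. P (a + x)"
proof -
  have "AE x in distr lebesgue lebesgue (\<lambda>x. a + x). P x"
    using assms unfolding distr_lebesgue_shift .
  then show ?thesis
    by (rule AE_distrD[OF measurable_lebesgue_shift])
qed

lemma lebesgue_integral_shift:
  fixes f :: "real \<Rightarrow> real"
  shows "(LINT x|lebesgue. f x) = (LINT x|lebesgue. f (a + x))"
  using lebesgue_integral_real_affine[of 1 f a] by simp

section \<open>Bounded periodic functions\<close>

lemma periodic_int_shift:
  assumes "\<And>x. g (x + 1) = g (x::real)"
  shows "g (x + of_int j) = g x"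
proof -
  interpret periodic_fun_simple' g by standard (use assms in simp)
  show ?thesis by (rule plus_of_int)
qed

text \<open>
  The conversion of the essential supremum to \<open>real\<close> sends \<open>\<infinity>\<close> to 0, which is why the norm is
  nonnegative even on functions outside \<open>Linf_T\<close>.
\<close>

lemma Linf_norm_nonneg: "0 \<le> Linf_norm g"
proof (cases "(\<lambda>x. ereal \<bar>g x\<bar>) \<in> borel_measurable lebesgue")
  case True
  have "esssup lebesgue (\<lambda>x::real. 0::ereal) \<le> esssup lebesgue (\<lambda>x. ereal \<bar>g x\<bar>)"
    by (rule esssup_mono) auto
  moreover have "esssup lebesgue (\<lambda>x::real. 0::ereal) = 0"
    by (rule esssup_const) simp
  ultimately show ?thesis
    unfolding Linf_norm_def by (simp add: real_of_ereal_pos)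
qed (simp add: Linf_norm_def esssup_non_measurable top_ereal_def)

lemma Linf_norm_le:
  assumes "g \<in> borel_measurable lebesgue" "AE x in lebesgue. \<bar>g x\<bar> \<le> M"
  shows "Linf_norm g \<le> M"
proof -
  have "esssup lebesgue (\<lambda>x. ereal \<bar>g x\<bar>) \<le> ereal M"
    using assms by (intro esssup_I) auto
  moreover have "esssup lebesgue (\<lambda>x::real. 0::ereal) \<le> esssup lebesgue (\<lambda>x. ereal \<bar>g x\<bar>)"
    by (rule esssup_mono) (use assms in auto)
  moreover have "esssup lebesgue (\<lambda>x::real. 0::ereal) = 0"
    by (rule esssup_const) simp
  ultimately show ?thesis
    unfolding Linf_norm_def
    by (cases "esssup lebesgue (\<lambda>x. ereal \<bar>g x\<bar>)") auto
qed

lemma Linf_T_AE_le_norm: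
  assumes "g \<in> Linf_T"
  shows "AE x in lebesgue. \<bar>g x\<bar> \<le> Linf_norm g"
proof -
  let ?s = "esssup lebesgue (\<lambda>x. ereal \<bar>g x\<bar>)"
  have m: "g \<in> borel_measurable lebesgue" and f: "?s < \<infinity>"
    using assms by (auto simp: Linf_T_def)
  have "esssup lebesgue (\<lambda>x::real. 0::ereal) \<le> ?s"
    by (rule esssup_mono) (use m in auto)
  moreover have "esssup lebesgue (\<lambda>x::real. 0::ereal) = 0"
    by (rule esssup_const) simp
  ultimately have "ereal (Linf_norm g) = ?s"
    using f unfolding Linf_norm_def by (cases ?s) auto
  then have "AE x in lebesgue. ereal \<bar>g x\<bar> \<le> ereal (Linf_norm g)"
    using esssup_AE[of "\<lambda>x. ereal \<bar>g x\<bar>" lebesgue] by simp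
  then show ?thesis by simp
qed

lemma Linf_TI:
  assumes "\<And>x. g (x + 1) = g x" "g \<in> borel_measurable lebesgue"
    "AE x in lebesgue. \<bar>g x\<bar> \<le> M"
  shows "g \<in> Linf_T"
proof -
  have "esssup lebesgue (\<lambda>x. ereal \<bar>g x\<bar>) \<le> ereal M"
    using assms by (intro esssup_I) auto
  also have "\<dots> < \<infinity>" by simp
  finally have "esssup lebesgue (\<lambda>x. ereal \<bar>g x\<bar>) < \<infinity>" .
  moreover have "periodic_fun_simple' g"
    by standard (use assms in simp)
  ultimately show ?thesis using assms(2) by (simp add: Linf_T_def)
qed

lemma Linf_T_periodic:
  assumes "g \<in> Linf_T" shows "g (x + 1) = g x"
proof -
  interpret periodic_fun_simple' g using assms by (simp add: Linf_T_def)
  show ?thesis by (rule plus_1)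
qed

lemma Linf_T_measurable: "g \<in> Linf_T \<Longrightarrow> g \<in> borel_measurable lebesgue"
  by (simp add: Linf_T_def)

lemma Linf_T_continuous:
  assumes "\<And>x. g (x + 1) = g x" "continuous_on UNIV g"
  shows "g \<in> Linf_T"
proof -
  obtain M where M: "\<And>x. x \<in> {0..1} \<Longrightarrow> \<bar>g x\<bar> \<le> M"
  proof -
    have "compact (g ` {0..1})"
      using assms(2) by (intro compact_continuous_image) (auto intro: continuous_on_subset)
    then have "bounded (g ` {0..1})" by (rule compact_imp_bounded)
    then obtain M where "\<forall>y\<in>g ` {0..1}. norm y \<le> M" unfolding bounded_iff by blast
    then show ?thesis by (intro that[of M]) auto
  qed
  have "\<bar>g x\<bar> \<le> M" for x
  proof -
    have "g (x + of_int (- \<lfloor>x\<rfloor>)) = g x" by (rule periodic_int_shift) (rule assms)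
    moreover have "x + of_int (- \<lfloor>x\<rfloor>) \<in> {0..1}"
      by (auto, linarith+)
    ultimately show ?thesis using M by metis
  qed
  moreover have "g \<in> borel_measurable lebesgue"
    using assms(2) by (intro borel_imp_lebesgue_measurable borel_measurable_continuous_onI)
  ultimately show ?thesis using assms(1) by (intro Linf_TI[where M=M]) auto
qed

text \<open>
  The linear growth condition lets one lemma serve both for truncating functions such as
  \<open>x / sqrt (x\<^sup>2 + \<epsilon>\<^sup>2)\<close> and for \<open>sqrt (x\<^sup>2 + \<epsilon>\<^sup>2)\<close>, which grows like \<open>\<bar>x\<bar>\<close>.
\<close>

lemma Linf_T_compose:
  assumes "g \<in> Linf_T" "\<phi> \<in> borel_measurable borel" "\<And>x. \<bar>\<phi> x\<bar> \<le> a + b * \<bar>x\<bar>" "b \<ge> 0"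
  shows "(\<lambda>x. \<phi> (g x)) \<in> Linf_T"
proof (rule Linf_TI[where M = "a + b * Linf_norm g"])
  show "AE x in lebesgue. \<bar>\<phi> (g x)\<bar> \<le> a + b * Linf_norm g"
    using Linf_T_AE_le_norm[OF assms(1)]
  proof eventually_elim
    case (elim x)
    then show ?case
      using assms(3)[of "g x"] mult_left_mono[OF elim assms(4)] by linarith
  qed
qed (use assms in \<open>auto simp: Linf_T_periodic intro: measurable_compose Linf_T_measurable\<close>)

lemma Linf_T_const: "(\<lambda>x. c) \<in> Linf_T"
  by (rule Linf_T_continuous) auto

lemma Linf_T_add:
  assumes "f \<in> Linf_T" "g \<in> Linf_T" shows "(\<lambda>x. f x + g x) \<in> Linf_T"
proof (rule Linf_TI[where M = "Linf_norm f + Linf_norm g"])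
  show "AE x in lebesgue. \<bar>f x + g x\<bar> \<le> Linf_norm f + Linf_norm g"
    using Linf_T_AE_le_norm[OF assms(1)] Linf_T_AE_le_norm[OF assms(2)]
    by eventually_elim linarith
qed (use assms in \<open>auto simp: Linf_T_periodic intro: borel_measurable_add Linf_T_measurable\<close>)

lemma Linf_T_mult:
  assumes "f \<in> Linf_T" "g \<in> Linf_T" shows "(\<lambda>x. f x * g x) \<in> Linf_T"
proof (rule Linf_TI[where M = "Linf_norm f * Linf_norm g"])
  show "AE x in lebesgue. \<bar>f x * g x\<bar> \<le> Linf_norm f * Linf_norm g"
    using Linf_T_AE_le_norm[OF assms(1)] Linf_T_AE_le_norm[OF assms(2)]
    by eventually_elim (simp add: abs_mult mult_mono Linf_norm_nonneg)
qed (use assms in \<open>auto simp: Linf_T_periodic intro: borel_measurable_times Linf_T_measurable\<close>)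

lemma Linf_T_cmult: "f \<in> Linf_T \<Longrightarrow> (\<lambda>x. c * f x) \<in> Linf_T"
  by (intro Linf_T_mult Linf_T_const)

lemma Linf_T_uminus: "f \<in> Linf_T \<Longrightarrow> (\<lambda>x. - f x) \<in> Linf_T"
  using Linf_T_cmult[of f "-1"] by simp

lemma Linf_T_diff: "f \<in> Linf_T \<Longrightarrow> g \<in> Linf_T \<Longrightarrow> (\<lambda>x. f x - g x) \<in> Linf_T"
  using Linf_T_add[of f "\<lambda>x. - g x"] Linf_T_uminus by simp

lemma Linf_T_abs: "f \<in> Linf_T \<Longrightarrow> (\<lambda>x. \<bar>f x\<bar>) \<in> Linf_T"
  by (rule Linf_T_compose[where a=0 and b=1]) auto

lemma Linf_T_sum: "(\<And>i. i \<in> I \<Longrightarrow> f i \<in> Linf_T) \<Longrightarrow> (\<lambda>x. \<Sum>i\<in>I. f i x) \<in> Linf_T"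
  by (induction I rule: infinite_finite_induct) (auto intro: Linf_T_const Linf_T_add)

lemma Linf_T_shift:
  assumes "g \<in> Linf_T" shows "(\<lambda>x. g (a + x)) \<in> Linf_T"
proof (rule Linf_TI[where M = "Linf_norm g"])
  show "g (a + (x + 1)) = g (a + x)" for x
    using Linf_T_periodic[OF assms, of "a + x"] by (simp add: add.assoc)
qed (use assms in \<open>auto intro: borel_measurable_lebesgue_shift Linf_T_measurable
      AE_lebesgue_shift Linf_T_AE_le_norm\<close>)

lemmas Linf_T_intros = Linf_T_const Linf_T_add Linf_T_mult Linf_T_uminus Linf_T_diff
  Linf_T_abs Linf_T_sum

lemma Linf_T_set_integrable:
  assumes "g \<in> Linf_T" "S \<in> sets lebesgue" "bounded S"
  shows "set_integrable lebesgue S g"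
proof -
  have "emeasure lebesgue S < \<infinity>"
    using bounded_set_imp_lmeasurable[OF assms(3,2)] by (auto simp: fmeasurable_def)
  then show ?thesis
    unfolding set_integrable_def
    using assms Linf_T_AE_le_norm[OF assms(1)]
    by (intro integrableI_bounded_set_indicator[where B = "Linf_norm g"]) (auto intro: Linf_T_measurable)
qed

lemma Linf_T_integrable_mult:
  assumes g: "g \<in> Linf_T" and k: "integrable lebesgue k"
  shows "integrable lebesgue (\<lambda>t. g t * k t)"
proof (rule Bochner_Integration.integrable_bound)
  show "integrable lebesgue (\<lambda>t. Linf_norm g * \<bar>k t\<bar>)"
    using k by auto
  show "(\<lambda>t. g t * k t) \<in> borel_measurable lebesgue"
    using k Linf_T_measurable[OF g] by (intro borel_measurable_times) auto
  show "AE t in lebesgue. norm (g t * k t) \<le> norm (Linf_norm g * \<bar>k t\<bar>)"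
    using Linf_T_AE_le_norm[OF g]
    by eventually_elim (auto simp: abs_mult Linf_norm_nonneg intro: mult_right_mono)
qed

section \<open>Mean values over a period\<close>

text \<open>
  The period has length 1, so the integral over one period is the mean value.
\<close>

definition mean :: "(real \<Rightarrow> real) \<Rightarrow> real" where
  "mean p = (LINT t:{-1/2..1/2}|lebesgue. p t)"

lemma Linf_T_integrable_period: "p \<in> Linf_T \<Longrightarrow> set_integrable lebesgue {-1/2..1/2} p"
  by (rule Linf_T_set_integrable) auto

lemma mean_add: "p \<in> Linf_T \<Longrightarrow> q \<in> Linf_T \<Longrightarrow> mean (\<lambda>x. p x + q x) = mean p + mean q"
  unfolding mean_def by (intro set_integral_add Linf_T_integrable_period)

lemma mean_diff: "p \<in> Linf_T \<Longrightarrow> q \<in> Linf_T \<Longrightarrow> mean (\<lambda>x. p x - q x) = mean p - mean q"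
  unfolding mean_def by (intro set_integral_diff Linf_T_integrable_period)

lemma mean_cmult: "mean (\<lambda>x. c * p x) = c * mean p"
  unfolding mean_def by (rule set_integral_mult_right)

lemma mean_const: "mean (\<lambda>x. c) = c"
  unfolding mean_def set_lebesgue_integral_def by simp

lemma mean_uminus: "mean (\<lambda>x. - p x) = - mean p"
  using mean_cmult[of "-1" p] by simp

lemma mean_sum:
  "(\<And>i. i \<in> I \<Longrightarrow> p i \<in> Linf_T) \<Longrightarrow> mean (\<lambda>x. \<Sum>i\<in>I. p i x) = (\<Sum>i\<in>I. mean (p i))"
  by (induction I rule: infinite_finite_induct) (auto simp: mean_const mean_add Linf_T_sum)

lemma mean_mono_AE:
  assumes "p \<in> Linf_T" "q \<in> Linf_T" "AE x in lebesgue. p x \<le> q x"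
  shows "mean p \<le> mean q"
  unfolding mean_def using assms
  by (intro set_integral_mono_AE Linf_T_integrable_period) auto

lemma mean_mono: "p \<in> Linf_T \<Longrightarrow> q \<in> Linf_T \<Longrightarrow> (\<And>x. p x \<le> q x) \<Longrightarrow> mean p \<le> mean q"
  by (rule mean_mono_AE) auto

lemma abs_mean_le: "p \<in> Linf_T \<Longrightarrow> \<bar>mean p\<bar> \<le> mean (\<lambda>x. \<bar>p x\<bar>)"
  using mean_mono[of p "\<lambda>x. \<bar>p x\<bar>"] mean_mono[of "\<lambda>x. - p x" "\<lambda>x. \<bar>p x\<bar>"]
  by (auto simp: Linf_T_abs Linf_T_uminus mean_uminus abs_le_iff)

text \<open>
  The line is cut into the cells \<open>[j - 1/2, j + 1/2)\<close>, and each cell is moved back to the basic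
  period by an integer translation, which the periodic factor \<open>v\<close> does not notice. Since \<open>k\<close> has
  bounded support, only finitely many cells contribute.
\<close>

lemma integral_eq_mean_periodization:
  fixes N :: nat
  assumes v: "v \<in> Linf_T" and k: "integrable lebesgue k"
    and supp: "\<And>t. k t \<noteq> 0 \<Longrightarrow> \<bar>t\<bar> < real N"
  shows "(LINT t|lebesgue. v t * k t) = mean (\<lambda>t. v t * (\<Sum>j\<in>{-int N..int N}. k (of_int j + t)))"
proof -
  define A where "A = {-1/2..<1/2::real}"
  define F where "F t = v t * k t" for t
  have F: "integrable lebesgue F"
    unfolding F_def using v k by (rule Linf_T_integrable_mult)
  have int: "integrable lebesgue (\<lambda>t. indicator A (t - of_int j) * F t)" for j :: int
  proof -
    have "A' \<in> sets lebesgue" if "A' = {of_int j - 1/2..<of_int j + 1/2::real}" for A'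
      using that by simp
    moreover have "indicator A (t - of_int j) = (indicator {of_int j - 1/2..<of_int j + 1/2} t :: real)" for t
      by (auto simp: A_def indicator_def)
    ultimately show ?thesis
      using integrable_mult_indicator[of "{of_int j - 1/2..<of_int j + 1/2::real}" lebesgue F] F by simp
  qed
  \<comment> \<open>Exactly one cell contains t, namely the one with index \<open>\<lfloor>t + 1/2\<rfloor>\<close>.\<close>
  have split: "F t = (\<Sum>j\<in>{-int N..int N}. indicator A (t - of_int j) * F t)" for t
  proof (cases "F t = 0")
    case False
    then have "\<bar>t\<bar> < real N" using supp by (auto simp: F_def)
    then have "\<lfloor>t + 1/2\<rfloor> \<in> {-int N..int N}"
      by (auto simp: floor_le_iff le_floor_iff)
    moreover have "t - of_int j \<in> A \<longleftrightarrow> j = \<lfloor>t + 1/2\<rfloor>" for j :: int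
      unfolding A_def by (auto; linarith)
    ultimately show ?thesis
      by (simp add: indicator_def if_distrib[where f="\<lambda>x. x * _"] cong: if_cong)
  qed auto
  have fold1: "(LINT t|lebesgue. indicator A (t - of_int j) * F t)
        = (LINT t|lebesgue. indicator A t * (v t * k (of_int j + t)))" for j :: int
    by (subst lebesgue_integral_shift[where a = "of_int j"])
       (use periodic_int_shift[of v, OF Linf_T_periodic[OF v]] in \<open>simp add: F_def add.commute\<close>)
  have int': "integrable lebesgue (\<lambda>t. indicator A t * (v t * k (of_int j + t)))" for j :: int
  proof -
    have "integrable lebesgue (\<lambda>t. k (of_int j + t))"
      using k lebesgue_integral_real_affine[of 1 k "of_int j"]
      using has_bochner_integral_lebesgue_real_affine_iff[of 1 k _ "of_int j"]
      by (auto simp: has_bochner_integral_iff)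
    then show ?thesis
      using integrable_mult_indicator[of A lebesgue "\<lambda>t. v t * k (of_int j + t)"]
        Linf_T_integrable_mult[OF v] by (auto simp: A_def)
  qed
  have "(LINT t|lebesgue. F t) = (LINT t|lebesgue. (\<Sum>j\<in>{-int N..int N}. indicator A (t - of_int j) * F t))"
    using split by (intro Bochner_Integration.integral_cong) auto
  also have "\<dots> = (\<Sum>j\<in>{-int N..int N}. LINT t|lebesgue. indicator A t * (v t * k (of_int j + t)))"
    by (subst Bochner_Integration.integral_sum) (auto simp: int fold1)
  also have "\<dots> = (LINT t|lebesgue. (\<Sum>j\<in>{-int N..int N}. indicator A t * (v t * k (of_int j + t))))"
    by (subst Bochner_Integration.integral_sum) (auto simp: int')
  also have "\<dots> = (LINT t|lebesgue. indicator {-1/2..1/2} t *\<^sub>R (v t * (\<Sum>j\<in>{-int N..int N}. k (of_int j + t))))"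
  proof (rule Bochner_Integration.integral_cong_AE)
    have kj: "(\<lambda>t. k (of_int j + t)) \<in> borel_measurable lebesgue" for j :: int
      using k by (intro borel_measurable_lebesgue_shift) auto
    note [measurable] = kj
    have [measurable]: "v \<in> borel_measurable lebesgue" by (rule Linf_T_measurable[OF v])
    have [measurable]: "A \<in> sets lebesgue" "{-1/2..1/2::real} \<in> sets lebesgue"
      by (simp_all add: A_def)
    have [measurable]: "(\<lambda>x::real. x) \<in> borel_measurable lebesgue"
      by (intro borel_imp_lebesgue_measurable) simp
    show "(\<lambda>t. \<Sum>j\<in>{-int N..int N}. indicator A t * (v t * k (of_int j + t))) \<in> borel_measurable lebesgue"
      by measurable
    show "(\<lambda>t. indicator {-1/2..1/2} t *\<^sub>R (v t * (\<Sum>j\<in>{-int N..int N}. k (of_int j + t)))) \<in> borel_measurable lebesgue"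
      by measurable
    have "AE t in lebesgue. t \<noteq> (1/2::real)"
      by (intro AE_completion AE_lborel_singleton)
    then show "AE t in lebesgue. (\<Sum>j\<in>{-int N..int N}. indicator A t * (v t * k (of_int j + t)))
       = indicator {-1/2..1/2} t *\<^sub>R (v t * (\<Sum>j\<in>{-int N..int N}. k (of_int j + t)))"
      by eventually_elim (auto simp: A_def indicator_def sum_distrib_left)
  qed
  finally show ?thesis by (simp add: F_def mean_def set_lebesgue_integral_def)
qed

text \<open>
  This is the folding lemma for \<open>k\<close> the indicator of a half-open interval \<open>I\<close> of length 1: the
  integer translates of \<open>I\<close> tile the line, so the periodization of \<open>k\<close> is constantly 1.
\<close>

lemma mean_shift:
  assumes p: "p \<in> Linf_T" shows "mean (\<lambda>t. p (a + t)) = mean p"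
proof -
  define I where "I = {a - 1/2..<a + 1/2}"
  obtain N :: nat where N: "real N > \<bar>a\<bar> + 1" using reals_Archimedean2 by blast
  have "mean (\<lambda>t. p (a + t)) = (LINT t|lebesgue. indicator {a - 1/2..a + 1/2} t * p t)"
    unfolding mean_def set_lebesgue_integral_def
    by (subst (2) lebesgue_integral_shift[where a = a])
       (auto intro!: Bochner_Integration.integral_cong simp: indicator_def)
  also have "\<dots> = (LINT t|lebesgue. p t * indicator I t)"
  proof (rule Bochner_Integration.integral_cong_AE)
    have [measurable]: "p \<in> borel_measurable lebesgue" by (rule Linf_T_measurable[OF p])
    have [measurable]: "(\<lambda>x::real. x) \<in> borel_measurable lebesgue"
      by (intro borel_imp_lebesgue_measurable) simp
    show "(\<lambda>t. indicator {a - 1/2..a + 1/2} t * p t) \<in> borel_measurable lebesgue" by measurable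
    have [measurable]: "I \<in> sets lebesgue" by (simp add: I_def)
    show "(\<lambda>t. p t * indicator I t) \<in> borel_measurable lebesgue" by measurable
    have "AE t in lebesgue. t \<noteq> a + 1/2"
      by (intro AE_completion AE_lborel_singleton)
    then show "AE t in lebesgue. indicator {a - 1/2..a + 1/2} t * p t = p t * indicator I t"
      by eventually_elim (auto simp: I_def indicator_def)
  qed
  also have "\<dots> = mean (\<lambda>t. p t * (\<Sum>j\<in>{-int N..int N}. indicator I (of_int j + t)))"
  proof (rule integral_eq_mean_periodization[OF p])
    show "integrable lebesgue (indicator I :: real \<Rightarrow> real)"
      unfolding I_def by (rule integrable_real_indicator) auto
    show "\<bar>t\<bar> < real N" if "indicator I t \<noteq> (0::real)" for t
    proof -
      have "t \<in> I" using that by (auto simp: indicator_def split: if_splits)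
      then show ?thesis using N unfolding I_def by (auto; linarith)
    qed
  qed
  also have "\<dots> = mean p"
    unfolding mean_def
  proof (rule set_lebesgue_integral_cong)
    show "\<forall>t. t \<in> {-1/2..1/2} \<longrightarrow> p t * (\<Sum>j\<in>{-int N..int N}. indicator I (of_int j + t)) = p t"
    proof (intro allI impI)
      fix t :: real assume t: "t \<in> {-1/2..1/2}"
      have eq: "of_int j + t \<in> I \<longleftrightarrow> j = \<lceil>a - 1/2 - t\<rceil>" for j :: int
        unfolding I_def by (auto; linarith)
      have "\<lceil>a - 1/2 - t\<rceil> \<in> {-int N..int N}"
        using t N by (auto simp: ceiling_le_iff le_ceiling_iff)
      then show "p t * (\<Sum>j\<in>{-int N..int N}. indicator I (of_int j + t)) = p t"
        using eq by (simp add: indicator_def cong: if_cong)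
    qed
  qed auto
  finally show ?thesis .
qed

section \<open>Trigonometric polynomials and their annihilator\<close>

text \<open>
  The functions \<open>cas k\<close> with \<open>\<bar>k\<bar> < n\<close> span \<open>trig_poly n\<close>. In contrast to the separate cosines and sines
  they form one orthonormal family, because
  \<open>cas a \<sqdot> cas b = cos (a - b) + sin (a + b)\<close>, and translation acts on them by the single
  rule \<open>cas_shift\<close>.
\<close>

definition cas :: "int \<Rightarrow> real \<Rightarrow> real" where
  "cas k x = cos (2 * pi * of_int k * x) + sin (2 * pi * of_int k * x)"

lemma cas_shift:
  "cas k (x + y) = cos (2 * pi * of_int k * y) * cas k x + sin (2 * pi * of_int k * y) * cas (- k) x"
  by (simp add: cas_def cos_add sin_add algebra_simps)

lemma continuous_on_cas: "continuous_on S (cas k)"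
  unfolding cas_def by (intro continuous_intros)

lemma abs_cas_le: "\<bar>cas k x\<bar> \<le> 2"
  unfolding cas_def
  using abs_cos_le_one[of "2 * pi * of_int k * x"] abs_sin_le_one[of "2 * pi * of_int k * x"] by linarith

lemma cos_sin_periodic:
  "cos (2 * pi * of_int k * (x + 1)) = cos (2 * pi * of_int k * x)"
  "sin (2 * pi * of_int k * (x + 1)) = sin (2 * pi * of_int k * x)"
  by (simp_all add: distrib_left cos_add sin_add)

lemma cos_sin_in_Linf_T:
  "(\<lambda>x. cos (2 * pi * of_int k * x)) \<in> Linf_T" "(\<lambda>x. sin (2 * pi * of_int k * x)) \<in> Linf_T"
  by (rule Linf_T_continuous; intro cos_sin_periodic continuous_intros)+

lemma cas_in_Linf_T: "cas k \<in> Linf_T"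
  using Linf_T_add[OF cos_sin_in_Linf_T] by (simp add: cas_def[abs_def])

lemma mean_cos_sin:
  "mean (\<lambda>x. cos (2 * pi * of_int k * x)) = (if k = 0 then 1 else 0)"
  "mean (\<lambda>x. sin (2 * pi * of_int k * x)) = 0"
proof -
  have "mean (\<lambda>x. cos (2 * pi * of_int k * x)) = 0 \<and> mean (\<lambda>x. sin (2 * pi * of_int k * x)) = 0"
    if k: "k \<noteq> 0"
  proof -
    \<comment> \<open>A translation by half a wavelength changes the sign, so the mean equals its own negative.\<close>
    have half: "2 * pi * of_int k * (1 / (2 * of_int k) + x) = 2 * pi * of_int k * x + pi" for x
      using k by (simp add: field_simps)
    show ?thesis
      using mean_shift[OF cos_sin_in_Linf_T(1)[of k], of "1 / (2 * of_int k)"]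
        mean_shift[OF cos_sin_in_Linf_T(2)[of k], of "1 / (2 * of_int k)"]
      unfolding half by (simp add: mean_uminus)
  qed
  then show "mean (\<lambda>x. cos (2 * pi * of_int k * x)) = (if k = 0 then 1 else 0)"
    "mean (\<lambda>x. sin (2 * pi * of_int k * x)) = 0"
    by (cases "k = 0"; simp add: mean_const)+
qed

lemma mean_cas_mult: "mean (\<lambda>x. cas k x * cas l x) = (if k = l then 1 else 0)"
proof -
  have "cas k x * cas l x = cos (2 * pi * of_int (k - l) * x) + sin (2 * pi * of_int (k + l) * x)" for x
    by (simp add: cas_def left_diff_distrib right_diff_distrib distrib_left distrib_right
        cos_diff sin_add algebra_simps)
  then show ?thesis
    by (simp only: mean_add[OF cos_sin_in_Linf_T] mean_cos_sin) simp
qed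

lemma trig_poly_zero: "(\<lambda>x. 0) \<in> trig_poly n"
  unfolding trig_poly_def by (intro CollectI exI[of _ "\<lambda>_. 0"]) simp

lemma trig_poly_add:
  assumes "\<sigma> \<in> trig_poly n" "\<tau> \<in> trig_poly n" shows "(\<lambda>x. \<sigma> x + \<tau> x) \<in> trig_poly n"
proof -
  obtain a b a' b' where
    "\<sigma> = (\<lambda>x. (\<Sum>j<n. a j * cos (2 * pi * real j * x)) + (\<Sum>j\<in>{1..<n}. b j * sin (2 * pi * real j * x)))"
    "\<tau> = (\<lambda>x. (\<Sum>j<n. a' j * cos (2 * pi * real j * x)) + (\<Sum>j\<in>{1..<n}. b' j * sin (2 * pi * real j * x)))"
    using assms unfolding trig_poly_def by blast
  then show ?thesis
    unfolding trig_poly_def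
    by (intro CollectI exI[of _ "\<lambda>j. a j + a' j"] exI[of _ "\<lambda>j. b j + b' j"])
       (simp add: distrib_right sum.distrib algebra_simps)
qed

lemma trig_poly_cmult:
  assumes "\<tau> \<in> trig_poly n" shows "(\<lambda>x. c * \<tau> x) \<in> trig_poly n"
proof -
  obtain a b where
    "\<tau> = (\<lambda>x. (\<Sum>j<n. a j * cos (2 * pi * real j * x)) + (\<Sum>j\<in>{1..<n}. b j * sin (2 * pi * real j * x)))"
    using assms unfolding trig_poly_def by blast
  then show ?thesis
    unfolding trig_poly_def
    by (intro CollectI exI[of _ "\<lambda>j. c * a j"] exI[of _ "\<lambda>j. c * b j"])
       (simp add: distrib_left sum_distrib_left mult.assoc)
qed

lemma cas_in_trig_poly:
  assumes "k \<in> {-int n<..<int n}" shows "cas k \<in> trig_poly n"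
proof -
  define m where "m = nat \<bar>k\<bar>"
  have m: "m < n" "k = int m \<or> k = - int m" using assms by (auto simp: m_def)
  define s where "s = (if k = int m then 1 else -1::real)"
  have "(\<Sum>j\<in>{1..<n}. (if j = m then s else 0) * sin (2 * pi * real j * x)) = s * sin (2 * pi * real m * x)" for x
    using m(1) by (cases "m = 0") (simp_all add: if_distrib[where f="\<lambda>x. x * _"] cong: if_cong)
  moreover have "cas k x = cos (2 * pi * real m * x) + s * sin (2 * pi * real m * x)" for x
    using m(2) by (auto simp: cas_def s_def)
  ultimately show ?thesis
    unfolding trig_poly_def using m(1)
    by (intro CollectI exI[of _ "\<lambda>j. if j = m then 1 else 0"] exI[of _ "\<lambda>j. if j = m then s else 0"])
       (auto simp: if_distrib[where f="\<lambda>x. x * _"] cong: if_cong)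
qed

text \<open>
  Linear properties of trigonometric polynomials need only be checked on the functions \<open>cas k\<close>.
\<close>

lemma trig_poly_induct [consumes 1, case_names cas add cmult zero]:
  assumes "\<tau> \<in> trig_poly n"
    and cas: "\<And>k. k \<in> {-int n<..<int n} \<Longrightarrow> P (cas k)"
    and add: "\<And>\<sigma> \<tau>. \<sigma> \<in> trig_poly n \<Longrightarrow> \<tau> \<in> trig_poly n \<Longrightarrow> P \<sigma> \<Longrightarrow> P \<tau> \<Longrightarrow> P (\<lambda>x. \<sigma> x + \<tau> x)"
    and cmult: "\<And>c \<tau>. \<tau> \<in> trig_poly n \<Longrightarrow> P \<tau> \<Longrightarrow> P (\<lambda>x. c * \<tau> x)"
    and zero: "P (\<lambda>x. 0)"
  shows "P \<tau>"
proof -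
  define Q where "Q \<sigma> \<longleftrightarrow> \<sigma> \<in> trig_poly n \<and> P \<sigma>" for \<sigma>
  have Qadd: "Q (\<lambda>x. \<sigma> x + \<tau> x)" if "Q \<sigma>" "Q \<tau>" for \<sigma> \<tau>
    using that by (auto simp: Q_def intro: add trig_poly_add)
  have Qc: "Q (\<lambda>x. c * \<tau> x)" if "Q \<tau>" for c \<tau>
    using that by (auto simp: Q_def intro: cmult trig_poly_cmult)
  have Qs: "Q (\<lambda>x. \<Sum>i\<in>I. f i x)" if "\<And>i. i \<in> I \<Longrightarrow> Q (f i)" for I :: "nat set" and f
    using that
    by (induction I rule: infinite_finite_induct) (auto simp: Q_def intro: zero trig_poly_zero add trig_poly_add)
  have Qcos: "Q (\<lambda>x. cos (2 * pi * real j * x))" and Qsin: "Q (\<lambda>x. sin (2 * pi * real j * x))"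
    if "j < n" for j
  proof -
    have 1: "Q (cas (int j))" "Q (cas (- int j))"
      using that by (auto simp: Q_def intro: cas cas_in_trig_poly)
    have "Q (\<lambda>x. (1/2) * (cas (int j) x + cas (- int j) x))"
      "Q (\<lambda>x. (1/2) * (cas (int j) x + -1 * cas (- int j) x))"
      by (intro Qc Qadd 1)+
    then show "Q (\<lambda>x. cos (2 * pi * real j * x))" "Q (\<lambda>x. sin (2 * pi * real j * x))"
      by (simp_all add: cas_def)
  qed
  obtain a b where
    "\<tau> = (\<lambda>x. (\<Sum>j<n. a j * cos (2 * pi * real j * x)) + (\<Sum>j\<in>{1..<n}. b j * sin (2 * pi * real j * x)))"
    using assms(1) unfolding trig_poly_def by blast
  moreover have "Q (\<lambda>x. (\<Sum>j<n. a j * cos (2 * pi * real j * x)) + (\<Sum>j\<in>{1..<n}. b j * sin (2 * pi * real j * x)))"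
    by (intro Qadd Qs Qc Qcos Qsin) auto
  ultimately show ?thesis by (simp add: Q_def)
qed

lemma trig_poly_in_Linf_T: "\<tau> \<in> trig_poly n \<Longrightarrow> \<tau> \<in> Linf_T"
  by (induction rule: trig_poly_induct) (auto intro: cas_in_Linf_T Linf_T_intros)

lemma trig_poly_continuous: "\<tau> \<in> trig_poly n \<Longrightarrow> continuous_on UNIV \<tau>"
  by (induction rule: trig_poly_induct) (auto intro: continuous_on_cas continuous_intros)

lemma trig_poly_bounded:
  assumes "\<tau> \<in> trig_poly n" obtains B where "\<And>x. \<bar>\<tau> x\<bar> \<le> B" "B > 0"
proof -
  have "\<exists>B. \<forall>x. \<bar>\<tau> x\<bar> \<le> B"
    using assms
  proof (induction rule: trig_poly_induct)
    case (add \<sigma> \<tau>)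
    then obtain A B where "\<forall>x. \<bar>\<sigma> x\<bar> \<le> A" "\<forall>x. \<bar>\<tau> x\<bar> \<le> B" by auto
    then have "\<forall>x. \<bar>\<sigma> x + \<tau> x\<bar> \<le> A + B" by (meson abs_triangle_ineq add_mono order_trans)
    then show ?case ..
  next
    case (cmult c \<tau>)
    then obtain B where "\<forall>x. \<bar>\<tau> x\<bar> \<le> B" by auto
    then have "\<forall>x. \<bar>c * \<tau> x\<bar> \<le> \<bar>c\<bar> * B" by (simp add: abs_mult mult_left_mono)
    then show ?case ..
  qed (use abs_cas_le in auto)
  then obtain B where "\<forall>x. \<bar>\<tau> x\<bar> \<le> B" ..
  then show ?thesis by (intro that[of "\<bar>B\<bar> + 1"]) (auto intro: order_trans)
qed

lemma trig_poly_shift: "\<tau> \<in> trig_poly n \<Longrightarrow> (\<lambda>x. \<tau> (x + a)) \<in> trig_poly n"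
proof (induction rule: trig_poly_induct)
  case (cas k)
  then show ?case unfolding cas_shift
    by (intro trig_poly_add trig_poly_cmult cas_in_trig_poly) auto
qed (auto intro: trig_poly_zero trig_poly_add trig_poly_cmult)

lemma trig_poly_reflect: "\<tau> \<in> trig_poly n \<Longrightarrow> (\<lambda>x. \<tau> (- x)) \<in> trig_poly n"
proof (induction rule: trig_poly_induct)
  case (cas k)
  have "(\<lambda>x. cas k (- x)) = cas (- k)" by (auto simp: cas_def)
  then show ?case using cas by (auto intro: cas_in_trig_poly)
qed (auto intro: trig_poly_zero trig_poly_add trig_poly_cmult)

lemma integrable_mult_bounded:
  fixes k \<psi> :: "'a \<Rightarrow> real"
  assumes "integrable M k" "\<psi> \<in> borel_measurable M" "\<And>t. \<bar>\<psi> t\<bar> \<le> B"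
  shows "integrable M (\<lambda>t. k t * \<psi> t)"
proof (rule Bochner_Integration.integrable_bound)
  show "integrable M (\<lambda>t. B * \<bar>k t\<bar>)" using assms by auto
  show "(\<lambda>t. k t * \<psi> t) \<in> borel_measurable M" using assms by auto
  have "\<bar>k t\<bar> * \<bar>\<psi> t\<bar> \<le> \<bar>B\<bar> * \<bar>k t\<bar>" for t
    using assms(3)[of t] by (subst mult.commute) (intro mult_right_mono, auto)
  then show "AE t in M. norm (k t * \<psi> t) \<le> norm (B * \<bar>k t\<bar>)"
    by (simp add: abs_mult)
qed

text \<open>
  Averages of translates of \<open>\<tau>\<close> stay in the same space, since a translate of \<open>cas k\<close> is a combination of
  \<open>cas k\<close> and \<open>cas (- k)\<close> with coefficients that depend only on the translation. The map \<open>\<phi>\<close>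
  allows both convolution and correlation.
\<close>

lemma trig_poly_average:
  assumes k: "integrable M k" and \<phi>: "\<phi> \<in> borel_measurable M" and \<tau>: "\<tau> \<in> trig_poly n"
  shows "(\<lambda>x. \<integral>t. k t * \<tau> (x + \<phi> t) \<partial>M) \<in> trig_poly n"
  using \<tau>
proof (induction rule: trig_poly_induct)
  case (cas l)
  let ?c = "\<lambda>t. cos (2 * pi * of_int l * \<phi> t)" and ?s = "\<lambda>t. sin (2 * pi * of_int l * \<phi> t)"
  have int: "integrable M (\<lambda>t. k t * ?c t)" "integrable M (\<lambda>t. k t * ?s t)"
    by (rule integrable_mult_bounded[OF k, where B=1]; use \<phi> in measurable; simp)+
  have "(\<integral>t. k t * cas l (x + \<phi> t) \<partial>M)
      = (\<integral>t. k t * ?c t \<partial>M) * cas l x + (\<integral>t. k t * ?s t \<partial>M) * cas (- l) x" for x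
  proof -
    have "(\<integral>t. k t * cas l (x + \<phi> t) \<partial>M) = (\<integral>t. k t * ?c t * cas l x + k t * ?s t * cas (- l) x \<partial>M)"
      unfolding cas_shift by (simp add: algebra_simps)
    then show ?thesis using int by simp
  qed
  then show ?case using cas
    by (auto intro!: trig_poly_add trig_poly_cmult cas_in_trig_poly)
next
  case (add \<sigma> \<tau>)
  have int: "integrable M (\<lambda>t. k t * \<rho> (x + \<phi> t))" if \<rho>: "\<rho> \<in> trig_poly n" for \<rho> x
  proof -
    obtain B where B: "\<And>x. \<bar>\<rho> x\<bar> \<le> B" using trig_poly_bounded[OF \<rho>] by blast
    have "\<rho> \<in> borel_measurable borel"
      by (intro borel_measurable_continuous_onI trig_poly_continuous[OF \<rho>])
    then show ?thesis using \<phi> B by (intro integrable_mult_bounded[OF k]) auto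
  qed
  show ?case
    using trig_poly_add[OF add(3,4)] int[OF add(1)] int[OF add(2)] by (simp add: distrib_left)
next
  case (cmult c \<tau>)
  then show ?case using trig_poly_cmult[OF cmult(2), of c] by (simp add: mult.left_commute)
qed (simp add: trig_poly_zero)

lemma trig_poly_perp_iff:
  "g \<in> trig_poly_perp n \<longleftrightarrow> g \<in> Linf_T \<and> (\<forall>k\<in>{-int n<..<int n}. mean (\<lambda>t. g t * cas k t) = 0)"
proof -
  have "mean (\<lambda>t. g t * \<tau> t) = 0"
    if g: "g \<in> Linf_T" and z: "\<forall>k\<in>{-int n<..<int n}. mean (\<lambda>t. g t * cas k t) = 0" and "\<tau> \<in> trig_poly n" for \<tau>
    using that(3)
  proof (induction rule: trig_poly_induct)
    case (add \<sigma> \<tau>)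
    then show ?case
      using mean_add[OF Linf_T_mult[OF g trig_poly_in_Linf_T[OF add(1)]] Linf_T_mult[OF g trig_poly_in_Linf_T[OF add(2)]]]
      by (simp add: distrib_left)
  next
    case (cmult c \<tau>)
    then show ?case using mean_cmult[of c "\<lambda>t. g t * \<tau> t"] by (simp add: mult.left_commute)
  qed (use z in \<open>auto simp: mean_const\<close>)
  then show ?thesis
    by (auto simp: trig_poly_perp_def mean_def cas_in_trig_poly)
qed

lemma trig_poly_perp_mean_eq_0:
  "g \<in> trig_poly_perp n \<Longrightarrow> \<tau> \<in> trig_poly n \<Longrightarrow> mean (\<lambda>t. g t * \<tau> t) = 0"
  by (simp add: trig_poly_perp_def mean_def)

lemma trig_poly_perp_in_Linf_T: "g \<in> trig_poly_perp n \<Longrightarrow> g \<in> Linf_T"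
  by (simp add: trig_poly_perp_def)

lemma trig_poly_perp_shift:
  assumes g: "g \<in> trig_poly_perp n" shows "(\<lambda>t. g (a + t)) \<in> trig_poly_perp n"
proof -
  have "mean (\<lambda>t. g (a + t) * \<tau> t) = 0" if \<tau>: "\<tau> \<in> trig_poly n" for \<tau>
  proof -
    have \<tau>': "(\<lambda>t. \<tau> (t + (-a))) \<in> trig_poly n" by (rule trig_poly_shift[OF \<tau>])
    have "mean (\<lambda>t. g (a + t) * \<tau> ((a + t) + (-a))) = mean (\<lambda>t. g t * \<tau> (t + (-a)))"
      by (rule mean_shift) (intro Linf_T_mult trig_poly_perp_in_Linf_T[OF g] trig_poly_in_Linf_T[OF \<tau>'])
    then show ?thesis using trig_poly_perp_mean_eq_0[OF g \<tau>'] by simp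
  qed
  then show ?thesis
    using Linf_T_shift[OF trig_poly_perp_in_Linf_T[OF g]] by (simp add: trig_poly_perp_def mean_def)
qed

lemma trig_poly_perp_uminus:
  assumes "g \<in> trig_poly_perp n" shows "(\<lambda>t. - g t) \<in> trig_poly_perp n"
  using assms mean_uminus by (auto simp: trig_poly_perp_iff Linf_T_uminus)

text \<open>
  The first frequency outside \<open>trig_poly n\<close>. It shows that the supremum defining \<open>c_const\<close> is taken over
  a nonempty set.
\<close>

lemma cas_in_trig_poly_perp: "cas (int n) \<in> trig_poly_perp n"
  by (auto simp: trig_poly_perp_iff cas_in_Linf_T mean_cas_mult)

section \<open>Convolution with the characteristic function of an interval\<close>

text \<open>
  A continuous function that exceeds a bound somewhere does so on a nonempty open set, which is not null.
\<close>

lemma continuous_abs_le_of_AE: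
  fixes u :: "real \<Rightarrow> real"
  assumes u: "continuous_on UNIV u" and M: "AE x in lebesgue. \<bar>u x\<bar> \<le> M"
  shows "\<bar>u x\<bar> \<le> M"
proof (rule ccontr)
  assume "\<not> \<bar>u x\<bar> \<le> M"
  define S where "S = {x. M < \<bar>u x\<bar>}"
  have "open S"
    unfolding S_def by (intro open_Collect_less continuous_intros u)
  moreover have "x \<in> S" using \<open>\<not> \<bar>u x\<bar> \<le> M\<close> by (simp add: S_def)
  moreover have "negligible S"
  proof -
    have "AE x in lebesgue. x \<notin> S" using M by (simp add: S_def not_less)
    moreover have "S \<in> sets lebesgue" using \<open>open S\<close> by simp
    ultimately show ?thesis by (simp add: negligible_iff_null_sets AE_iff_null_sets)
  qed
  ultimately show False using open_not_negligible by blast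
qed

lemma continuous_abs_le_Linf_norm:
  "u \<in> Linf_T \<Longrightarrow> continuous_on UNIV u \<Longrightarrow> \<bar>u x\<bar> \<le> Linf_norm u"
  by (rule continuous_abs_le_of_AE) (auto intro: Linf_T_AE_le_norm)

lemma chi_measurable: "chi h \<in> borel_measurable borel"
  unfolding chi_def by measurable

lemma chi_minus: "chi h (- x) = chi h x"
  by (auto simp: chi_def indicator_def)

lemma integrable_chi: "integrable lebesgue (chi h)"
proof -
  have "emeasure lborel {- h / 2<..<h / 2} < \<infinity>" by (rule emeasure_bounded_finite) simp
  then show ?thesis
    unfolding chi_def by (intro integrable_divide integrable_real_indicator) auto
qed

lemma convol_chi_eq_shifted_integral: "convol g (chi h) x = (LINT t|lebesgue. g (x + t) * chi h t)"
  unfolding convol_def by (subst lebesgue_integral_shift[where a=x]) (simp add: chi_minus)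

lemma convol_chi_eq_set_integral:
  assumes "h > 0"
  shows "convol g (chi h) x = (LINT t:{0<..<h}|lebesgue. g (x - h / 2 + t)) / h"
proof -
  have "convol g (chi h) x = (LINT t|lebesgue. g (x - h / 2 + t) * chi h (- h / 2 + t))"
    unfolding convol_chi_eq_shifted_integral
    by (subst lebesgue_integral_shift[where a="- h / 2"]) (simp add: algebra_simps)
  also have "\<dots> = (LINT t|lebesgue. (indicator {0<..<h} t *\<^sub>R g (x - h / 2 + t)) / h)"
    by (intro Bochner_Integration.integral_cong) (auto simp: chi_def indicator_def)
  finally show ?thesis by (simp add: set_lebesgue_integral_def)
qed

lemma convol_chi_eq_interval_integral:
  assumes "h > 0" "g \<in> Linf_T"
  shows "convol g (chi h) x = integral {x - h / 2..x + h / 2} g / h"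
proof -
  have "convol g (chi h) x = (LINT t|lebesgue. g t * chi h (- x + t))"
    unfolding convol_def using chi_minus[of h "- x + _"] by (simp add: algebra_simps)
  also have "\<dots> = (LINT t|lebesgue. (indicator {x - h / 2<..<x + h / 2} t *\<^sub>R g t) / h)"
    by (intro Bochner_Integration.integral_cong) (auto simp: chi_def indicator_def)
  also have "\<dots> = (LINT t:{x - h / 2<..<x + h / 2}|lebesgue. g t) / h"
    by (simp add: set_lebesgue_integral_def)
  also have "(LINT t:{x - h / 2<..<x + h / 2}|lebesgue. g t) = integral {x - h / 2<..<x + h / 2} g"
    by (rule set_lebesgue_integral_eq_integral) (rule Linf_T_set_integrable[OF assms(2)]; simp)
  finally show ?thesis by (simp add: integral_open_interval_real)
qed

text \<open>
  The convolution is a difference of two values of an indefinite integral. Continuity makes its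
  essential supremum an honest supremum, so that the value at a single point is bounded by
  the norm.
\<close>

lemma convol_chi_continuous:
  assumes h: "h > 0" and g: "g \<in> Linf_T"
  shows "continuous_on UNIV (convol g (chi h))"
proof -
  have "isCont (convol g (chi h)) x" for x
  proof -
    define R where "R = \<bar>x\<bar> + 1 + h"
    define G where "G y = integral {- R..y} g" for y
    have int: "g integrable_on {a..b}" for a b
      by (intro set_lebesgue_integral_eq_integral(1) Linf_T_set_integrable[OF g]) auto
    have contG: "continuous_on {- R..R} G"
      unfolding G_def by (rule indefinite_integral_continuous_1[OF int])
    have eq: "convol g (chi h) y = (G (y + h / 2) - G (y - h / 2)) / h"
      if "y \<in> {- \<bar>x\<bar> - 1<..<\<bar>x\<bar> + 1}" for y
    proof -
      have "G (y - h / 2) + integral {y - h / 2..y + h / 2} g = G (y + h / 2)"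
        unfolding G_def using that h
        by (intro Henstock_Kurzweil_Integration.integral_combine int) (auto simp: R_def)
      then show ?thesis by (simp add: convol_chi_eq_interval_integral[OF h g])
    qed
    have "continuous_on {- \<bar>x\<bar> - 1<..<\<bar>x\<bar> + 1} (\<lambda>y. (G (y + h / 2) - G (y - h / 2)) / h)"
      using h by (intro continuous_intros continuous_on_compose2[OF contG]) (auto simp: R_def)
    then have "continuous_on {- \<bar>x\<bar> - 1<..<\<bar>x\<bar> + 1} (convol g (chi h))"
      by (rule continuous_on_eq) (simp add: eq)
    then show ?thesis
      by (rule continuous_on_interior) (auto simp: interior_open)
  qed
  then show ?thesis by (simp add: continuous_on_eq_continuous_at)
qed

lemma convol_chi_in_Linf_T:
  assumes "h > 0" "g \<in> Linf_T" shows "convol g (chi h) \<in> Linf_T"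
proof (rule Linf_T_continuous[OF _ convol_chi_continuous[OF assms]])
  show "convol g (chi h) (x + 1) = convol g (chi h) x" for x
    using Linf_T_periodic[OF assms(2)]
    unfolding convol_chi_eq_shifted_integral by (metis add.commute add.left_commute)
qed

text \<open>
  The representative \<open>t - \<lfloor>t + 1/2\<rfloor>\<close> of \<open>t\<close> in \<open>[-1/2, 1/2)\<close> makes the function exactly periodic although the
  sum over the integer translates is truncated; the terms with \<open>\<bar>j\<bar> > h\<close> vanish there.
\<close>

definition periodized_chi :: "real \<Rightarrow> real \<Rightarrow> real" where
  "periodized_chi h t =
     (\<Sum>j\<in>{- int (nat \<lceil>h\<rceil>)..int (nat \<lceil>h\<rceil>)}. chi h (of_int j + (t - of_int \<lfloor>t + 1/2\<rfloor>)))"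

lemma periodized_chi_in_Linf_T:
  assumes "h > 0" shows "periodized_chi h \<in> Linf_T"
proof (rule Linf_TI)
  show "periodized_chi h (t + 1) = periodized_chi h t" for t
  proof -
    have "\<lfloor>t + 1 + 1/2\<rfloor> = \<lfloor>t + 1/2\<rfloor> + 1" by linarith
    then show ?thesis by (simp add: periodized_chi_def)
  qed
  note [measurable] = chi_measurable
  have "periodized_chi h \<in> borel_measurable borel"
    unfolding periodized_chi_def by measurable
  then show "periodized_chi h \<in> borel_measurable lebesgue"
    by (rule borel_imp_lebesgue_measurable)
  have "\<bar>chi h x\<bar> \<le> 1 / h" for x
    using assms by (auto simp: chi_def indicator_def)
  then have "\<bar>periodized_chi h t\<bar> \<le> (\<Sum>j\<in>{- int (nat \<lceil>h\<rceil>)..int (nat \<lceil>h\<rceil>)}. 1 / h)" for t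
    unfolding periodized_chi_def by (intro order_trans[OF sum_abs] sum_mono)
  then show "AE t in lebesgue. \<bar>periodized_chi h t\<bar> \<le> (\<Sum>j\<in>{- int (nat \<lceil>h\<rceil>)..int (nat \<lceil>h\<rceil>)}. 1 / h)"
    by simp
qed

lemma convol_chi_eq_mean:
  assumes h: "h > 0" and g: "g \<in> Linf_T"
  shows "convol g (chi h) x = mean (\<lambda>t. g (x + t) * periodized_chi h t)"
proof -
  define N where "N = nat \<lceil>h\<rceil>"
  have "convol g (chi h) x = mean (\<lambda>t. g (x + t) * (\<Sum>j\<in>{- int N..int N}. chi h (of_int j + t)))"
    unfolding convol_chi_eq_shifted_integral
  proof (rule integral_eq_mean_periodization[OF Linf_T_shift[OF g] integrable_chi])
    show "\<bar>t\<bar> < real N" if "chi h t \<noteq> 0" for t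
    proof -
      have "\<bar>t\<bar> < h / 2" using that by (auto simp: chi_def indicator_def split: if_splits)
      moreover have "h \<le> real N" unfolding N_def using h by linarith
      ultimately show ?thesis using h by linarith
    qed
  qed
  also have "\<dots> = mean (\<lambda>t. g (x + t) * periodized_chi h t)"
    unfolding mean_def
  proof (rule set_lebesgue_integral_cong)
    have "(\<Sum>j\<in>{- int N..int N}. chi h (of_int j + t)) = periodized_chi h t"
      if t: "t \<in> {-1/2..1/2}" for t :: real
    proof (cases "t = 1/2")
      case True
      \<comment> \<open>The representative of 1/2 is -1/2, so here the equality rests on the symmetry of \<open>chi h\<close>.\<close>
      have "chi h (of_int (- j) - 1/2) = chi h (of_int j + 1/2)" for j :: int
        using chi_minus[of h "of_int j + 1/2"] by simp
      then have "(\<Sum>j\<in>{- int N..int N}. chi h (of_int j + 1/2)) = (\<Sum>j\<in>{- int N..int N}. chi h (of_int j - 1/2))"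
        by (intro sum.reindex_bij_witness[of _ uminus uminus]) simp_all
      then show ?thesis unfolding True periodized_chi_def N_def[symmetric] by simp
    next
      case False
      then have "\<lfloor>t + 1/2\<rfloor> = 0" using t by (auto simp: floor_eq_iff)
      then show ?thesis by (simp add: periodized_chi_def N_def)
    qed
    then show "\<forall>t. t \<in> {-1/2..1/2} \<longrightarrow> g (x + t) * (\<Sum>j\<in>{- int N..int N}. chi h (of_int j + t))
        = g (x + t) * periodized_chi h t" by simp
  qed simp
  finally show ?thesis .
qed

section \<open>Duality for approximation in the mean\<close>

text \<open>
  The function \<open>sqrt (k\<^sup>2 + \<epsilon>\<^sup>2)\<close> is a smooth substitute for \<open>\<bar>k\<bar>\<close> with derivative
  \<open>k / sqrt (k\<^sup>2 + \<epsilon>\<^sup>2)\<close> and second derivative at most \<open>1 / \<epsilon>\<close>. The resulting quadratic upper bound follows from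
  the inequality \<open>2 r q \<le> r\<^sup>2 + q\<^sup>2\<close> between the old value \<open>r\<close> and the new value \<open>q\<close>.
\<close>

lemma sqrt_smoothing_step:
  fixes k d \<epsilon> :: real
  assumes "\<epsilon> > 0"
  shows "sqrt ((k - d)\<^sup>2 + \<epsilon>\<^sup>2) \<le> sqrt (k\<^sup>2 + \<epsilon>\<^sup>2) - d * (k / sqrt (k\<^sup>2 + \<epsilon>\<^sup>2)) + d\<^sup>2 / (2 * \<epsilon>)"
proof -
  define r where "r = sqrt (k\<^sup>2 + \<epsilon>\<^sup>2)"
  define q where "q = sqrt ((k - d)\<^sup>2 + \<epsilon>\<^sup>2)"
  have r2: "r\<^sup>2 = k\<^sup>2 + \<epsilon>\<^sup>2" and q2: "q\<^sup>2 = (k - d)\<^sup>2 + \<epsilon>\<^sup>2" by (simp_all add: r_def q_def)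
  have r\<epsilon>: "\<epsilon> \<le> r" unfolding r_def by (rule real_le_rsqrt) simp
  then have r0: "r > 0" using assms by simp
  have "2 * r * q \<le> r\<^sup>2 + q\<^sup>2" by (rule sum_squares_bound)
  then have "q \<le> (r\<^sup>2 + q\<^sup>2) / (2 * r)" using r0 by (simp add: field_simps)
  also have "\<dots> = r - d * (k / r) + d\<^sup>2 / (2 * r)"
  proof -
    have "r\<^sup>2 + q\<^sup>2 = 2 * r\<^sup>2 - 2 * k * d + d\<^sup>2" by (simp add: r2 q2 power2_diff)
    then show ?thesis using r0 by (simp add: field_simps power2_eq_square)
  qed
  also have "d\<^sup>2 / (2 * r) \<le> d\<^sup>2 / (2 * \<epsilon>)"
    using r\<epsilon> assms by (intro divide_left_mono) auto
  finally show ?thesis by (simp add: r_def q_def)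
qed

text \<open>
  This is the hard half of the duality between the \<open>L\<^sub>1\<close> distance of \<open>w\<close> to \<open>trig_poly n\<close> and the
  norm of \<open>w\<close> as a functional on the annihilator. The classical extremal functional is the sign of
  \<open>\<kappa> = w - \<tau>\<close> for a best approximation \<open>\<tau>\<close>, but it is sure to annihilate \<open>trig_poly n\<close> only when \<open>\<kappa>\<close> is
  nonzero almost everywhere, which can fail for a step function \<open>w\<close>.

  The sign is therefore replaced by \<open>g = \<kappa> / sqrt (\<kappa>\<^sup>2 + \<epsilon>\<^sup>2)\<close>, the derivative of the smoothed norm
  \<open>\<Phi>\<close>. If \<open>\<tau>\<close> minimizes \<open>\<Phi>\<close> up to \<open>s\<^sup>2\<close>, a step of size \<open>s\<close> in any direction \<open>cas k\<close> cannot
  gain more than \<open>s\<^sup>2\<close>, so \<open>g\<close> is orthogonal to \<open>cas k\<close> up to \<open>O(s)\<close>. Subtracting its orthogonal projection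
  gives a function \<open>g'\<close> that lies in the annihilator and exceeds the bound 1 by \<open>O(s)\<close> only. An exact minimizer,
  and with it a compactness argument, is avoided in this way. The pairing with \<open>\<kappa>\<close> costs
  at most \<open>\<epsilon>\<close> because \<open>\<kappa>\<^sup>2 / sqrt (\<kappa>\<^sup>2 + \<epsilon>\<^sup>2) \<ge> \<bar>\<kappa>\<bar> - \<epsilon>\<close>.
\<close>

lemma L1_distance_le_dual_bound:
  assumes w: "w \<in> Linf_T" and C: "C \<ge> 0" and \<epsilon>: "\<epsilon> > 0"
    and dual: "\<And>g M. g \<in> trig_poly_perp n \<Longrightarrow> (\<And>t. \<bar>g t\<bar> \<le> M) \<Longrightarrow> mean (\<lambda>t. g t * w t) \<le> C * M"
  shows "\<exists>\<tau>\<in>trig_poly n. mean (\<lambda>t. \<bar>w t - \<tau> t\<bar>) \<le> C + 2 * \<epsilon>"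
proof -
  define K where "K = {-int n<..<int n}"
  define L where "L = 1 + 2 / \<epsilon>"
  define R where "R = 1 + 2 * real (card K) * L"
  \<comment> \<open>The size of s is what the last inequality of the proof asks for:
      \<open>s * R \<le> 1/2\<close> and \<open>(C (1 + s R) + \<epsilon>) / (1 - s R) \<le> C + 2 \<epsilon>\<close>.\<close>
  define s where "s = min (1/2) (\<epsilon> / (2 * C + 2 * \<epsilon>)) / R"
  define \<Phi> where "\<Phi> \<tau> = mean (\<lambda>t. sqrt ((w t - \<tau> t)\<^sup>2 + \<epsilon>\<^sup>2))" for \<tau>
  have L: "L > 0" using \<epsilon> by (simp add: L_def add_pos_pos)
  have R: "R \<ge> 1" using L by (simp add: R_def)
  have s: "s > 0" using R C \<epsilon> by (simp add: s_def)
  have sR: "s * R = min (1/2) (\<epsilon> / (2 * C + 2 * \<epsilon>))" using R by (simp add: s_def)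
  have smooth_in: "(\<lambda>t. sqrt ((k t)\<^sup>2 + \<epsilon>\<^sup>2)) \<in> Linf_T" if "k \<in> Linf_T" for k
  proof (rule Linf_T_compose[OF that, where a = \<epsilon> and b = 1])
    show "\<bar>sqrt (x\<^sup>2 + \<epsilon>\<^sup>2)\<bar> \<le> \<epsilon> + 1 * \<bar>x\<bar>" for x
      using sqrt_sum_squares_le_sum_abs[of x \<epsilon>] \<epsilon> by simp
  qed auto
  have "bdd_below (\<Phi> ` trig_poly n)"
  proof (rule bdd_belowI2)
    show "0 \<le> \<Phi> \<tau>" if "\<tau> \<in> trig_poly n" for \<tau>
      unfolding \<Phi>_def mean_def set_lebesgue_integral_def
      by (intro Bochner_Integration.integral_nonneg) auto
  qed
  then have inf_le: "Inf (\<Phi> ` trig_poly n) \<le> \<Phi> \<tau>" if "\<tau> \<in> trig_poly n" for \<tau>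
    using that by (rule cINF_lower)
  have ne: "\<Phi> ` trig_poly n \<noteq> {}" using trig_poly_zero by blast
  obtain \<tau> where \<tau>: "\<tau> \<in> trig_poly n" and near: "\<Phi> \<tau> \<le> Inf (\<Phi> ` trig_poly n) + s\<^sup>2"
    using cInf_lessD[OF ne, of "Inf (\<Phi> ` trig_poly n) + s\<^sup>2"] s by (auto intro: less_imp_le)
  define \<kappa> where "\<kappa> t = w t - \<tau> t" for t
  define g where "g t = \<kappa> t / sqrt ((\<kappa> t)\<^sup>2 + \<epsilon>\<^sup>2)" for t
  have \<kappa>: "\<kappa> \<in> Linf_T"
    using Linf_T_diff[OF w trig_poly_in_Linf_T[OF \<tau>]] by (simp add: \<kappa>_def[abs_def])
  have abs_quot: "\<bar>x / sqrt (x\<^sup>2 + \<epsilon>\<^sup>2)\<bar> \<le> 1" for x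
  proof -
    have "\<bar>x\<bar> \<le> sqrt (x\<^sup>2 + \<epsilon>\<^sup>2)" by (rule real_le_rsqrt) simp
    moreover have "sqrt (x\<^sup>2 + \<epsilon>\<^sup>2) > 0" using \<epsilon> by (simp add: add_nonneg_pos)
    ultimately show ?thesis by (simp add: divide_simps)
  qed
  have g: "g \<in> Linf_T"
    unfolding g_def by (rule Linf_T_compose[OF \<kappa>, where a=1 and b=0]) (use abs_quot in auto)
  have g1: "\<bar>g t\<bar> \<le> 1" for t using abs_quot by (simp add: g_def)
  define \<gamma> where "\<gamma> k = mean (\<lambda>t. g t * cas k t)" for k
  have gcas: "(\<lambda>t. g t * cas k t) \<in> Linf_T" for k
    by (intro Linf_T_mult g cas_in_Linf_T)
  have \<gamma>_le: "\<bar>\<gamma> k\<bar> \<le> s * L" if k: "k \<in> K" for k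
  proof -
    have "\<sigma> * \<gamma> k \<le> s * L" if \<sigma>: "\<bar>\<sigma>\<bar> = 1" for \<sigma>
    proof -
      have \<tau>': "(\<lambda>t. \<tau> t + s * \<sigma> * cas k t) \<in> trig_poly n"
        using k by (intro trig_poly_add trig_poly_cmult \<tau> cas_in_trig_poly) (simp add: K_def)
      have "\<Phi> \<tau> - s\<^sup>2 \<le> \<Phi> (\<lambda>t. \<tau> t + s * \<sigma> * cas k t)"
        using near inf_le[OF \<tau>'] by linarith
      also have "\<dots> \<le> mean (\<lambda>t. sqrt ((\<kappa> t)\<^sup>2 + \<epsilon>\<^sup>2) - s * \<sigma> * (g t * cas k t) + 2 * s\<^sup>2 / \<epsilon>)"
        unfolding \<Phi>_def
      proof (rule mean_mono)
        show "(\<lambda>t. sqrt ((w t - (\<tau> t + s * \<sigma> * cas k t))\<^sup>2 + \<epsilon>\<^sup>2)) \<in> Linf_T"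
          by (rule smooth_in) (intro Linf_T_diff w trig_poly_in_Linf_T[OF \<tau>'])
        show "(\<lambda>t. sqrt ((\<kappa> t)\<^sup>2 + \<epsilon>\<^sup>2) - s * \<sigma> * (g t * cas k t) + 2 * s\<^sup>2 / \<epsilon>) \<in> Linf_T"
          by (intro Linf_T_intros smooth_in \<kappa> gcas)
        fix t
        let ?d = "s * \<sigma> * cas k t"
        have "\<sigma>\<^sup>2 = 1" using \<sigma> by (metis power2_abs one_power2)
        moreover have "(cas k t)\<^sup>2 \<le> 2\<^sup>2" using abs_cas_le[of k t] by (metis abs_ge_zero power2_abs power_mono)
        ultimately have "?d\<^sup>2 \<le> 4 * s\<^sup>2"
          using mult_left_mono[of "(cas k t)\<^sup>2" 4 "s\<^sup>2"] by (simp add: power_mult_distrib mult.commute)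
        then have bound: "?d\<^sup>2 / (2 * \<epsilon>) \<le> 2 * s\<^sup>2 / \<epsilon>" using \<epsilon> by (simp add: field_simps)
        have diff: "w t - (\<tau> t + ?d) = \<kappa> t - ?d" by (simp add: \<kappa>_def)
        have pair: "?d * (\<kappa> t / sqrt ((\<kappa> t)\<^sup>2 + \<epsilon>\<^sup>2)) = s * \<sigma> * (g t * cas k t)"
          by (simp add: g_def)
        show "sqrt ((w t - (\<tau> t + ?d))\<^sup>2 + \<epsilon>\<^sup>2)
            \<le> sqrt ((\<kappa> t)\<^sup>2 + \<epsilon>\<^sup>2) - s * \<sigma> * (g t * cas k t) + 2 * s\<^sup>2 / \<epsilon>"
          unfolding diff using sqrt_smoothing_step[OF \<epsilon>, of "\<kappa> t" ?d] bound pair by linarith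
      qed
      also have "\<dots> = \<Phi> \<tau> - s * \<sigma> * \<gamma> k + 2 * s\<^sup>2 / \<epsilon>"
        unfolding \<Phi>_def \<gamma>_def \<kappa>_def[symmetric]
        using smooth_in[OF \<kappa>] Linf_T_cmult[OF gcas, of "s * \<sigma>" k] Linf_T_const[of "2 * s\<^sup>2 / \<epsilon>"]
        by (simp add: mean_add mean_diff Linf_T_diff mean_cmult mean_const)
      finally have "s * (\<sigma> * \<gamma> k) \<le> s * (s * L)"
        by (simp add: L_def algebra_simps power2_eq_square)
      then show ?thesis using s by simp
    qed
    from this[of 1] this[of "-1"] show ?thesis by simp
  qed
  \<comment> \<open>The functions cas k are orthonormal, so the sum is the orthogonal projection of g.\<close>
  define g' where "g' t = g t - (\<Sum>k\<in>K. \<gamma> k * cas k t)" for t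
  have proj: "(\<lambda>t. \<Sum>k\<in>K. \<gamma> k * cas k t) \<in> Linf_T"
    by (intro Linf_T_sum Linf_T_cmult cas_in_Linf_T)
  have g': "g' \<in> Linf_T"
    using Linf_T_diff[OF g proj] by (simp add: g'_def[abs_def])
  have proj_pair: "mean (\<lambda>t. g' t * p t) = mean (\<lambda>t. g t * p t) - (\<Sum>k\<in>K. \<gamma> k * mean (\<lambda>t. cas k t * p t))"
    if p: "p \<in> Linf_T" for p
  proof -
    have "(\<lambda>t. g' t * p t) = (\<lambda>t. g t * p t - (\<Sum>k\<in>K. \<gamma> k * (cas k t * p t)))"
      by (simp add: g'_def left_diff_distrib sum_distrib_right mult.assoc)
    then show ?thesis
      by (simp add: mean_diff mean_sum mean_cmult Linf_T_mult Linf_T_sum Linf_T_cmult g p cas_in_Linf_T)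
  qed
  have "finite K" by (simp add: K_def)
  have perp: "g' \<in> trig_poly_perp n"
    unfolding trig_poly_perp_iff
  proof (intro conjI ballI g')
    fix l assume "l \<in> {-int n<..<int n}"
    then have "l \<in> K" by (simp add: K_def)
    then show "mean (\<lambda>t. g' t * cas l t) = 0"
      using \<open>finite K\<close>
      by (simp add: proj_pair[OF cas_in_Linf_T] mean_cas_mult \<gamma>_def if_distrib[where f="\<lambda>x. _ * x"] cong: if_cong)
  qed
  have g'_le: "\<bar>g' t\<bar> \<le> 1 + s * R" for t
  proof -
    have "\<bar>\<Sum>k\<in>K. \<gamma> k * cas k t\<bar> \<le> (\<Sum>k\<in>K. s * L * 2)"
      by (intro order_trans[OF sum_abs] sum_mono)
         (use \<gamma>_le abs_cas_le s L in \<open>auto simp: abs_mult intro!: mult_mono\<close>)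
    also have "\<dots> \<le> s * R" using s by (simp add: R_def algebra_simps)
    finally show ?thesis using g1[of t] unfolding g'_def by linarith
  qed
  define D where "D = mean (\<lambda>t. \<bar>\<kappa> t\<bar>)"
  have D0: "0 \<le> D" using mean_mono[OF Linf_T_const[of 0] Linf_T_abs[OF \<kappa>]] by (simp add: D_def mean_const)
  have "D - \<epsilon> \<le> mean (\<lambda>t. g t * \<kappa> t)"
  proof -
    have "D - \<epsilon> = mean (\<lambda>t. \<bar>\<kappa> t\<bar> - \<epsilon>)"
      by (simp add: D_def mean_diff mean_const Linf_T_abs \<kappa> Linf_T_const)
    also have "\<dots> \<le> mean (\<lambda>t. g t * \<kappa> t)"
    proof (rule mean_mono)
      fix t
      define r where "r = sqrt ((\<kappa> t)\<^sup>2 + \<epsilon>\<^sup>2)"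
      have r: "r \<ge> \<epsilon>" "r \<ge> \<bar>\<kappa> t\<bar>" "r\<^sup>2 = (\<kappa> t)\<^sup>2 + \<epsilon>\<^sup>2"
        unfolding r_def by (auto intro: real_le_rsqrt)
      then have r0: "r > 0" using \<epsilon> by linarith
      have "g t * \<kappa> t = (r\<^sup>2 - \<epsilon>\<^sup>2) / r" unfolding r(3) by (simp add: g_def r_def power2_eq_square)
      also have "\<dots> = r - \<epsilon> * (\<epsilon> / r)" using r0 by (simp add: field_simps power2_eq_square)
      also have "\<dots> \<ge> \<bar>\<kappa> t\<bar> - \<epsilon>"
        using r r0 \<epsilon> mult_left_mono[of "\<epsilon> / r" 1 \<epsilon>] by simp
      finally show "\<bar>\<kappa> t\<bar> - \<epsilon> \<le> g t * \<kappa> t" .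
    qed (intro Linf_T_intros g \<kappa>)+
    finally show ?thesis .
  qed
  moreover have "(\<Sum>k\<in>K. \<gamma> k * mean (\<lambda>t. cas k t * \<kappa> t)) \<le> s * R * D"
  proof -
    have "\<bar>mean (\<lambda>t. cas k t * \<kappa> t)\<bar> \<le> 2 * D" for k
    proof -
      have "\<bar>mean (\<lambda>t. cas k t * \<kappa> t)\<bar> \<le> mean (\<lambda>t. \<bar>cas k t * \<kappa> t\<bar>)"
        by (intro abs_mean_le Linf_T_mult cas_in_Linf_T \<kappa>)
      also have "\<dots> \<le> mean (\<lambda>t. 2 * \<bar>\<kappa> t\<bar>)"
        by (rule mean_mono) (auto simp: abs_mult intro!: Linf_T_intros Linf_T_cmult cas_in_Linf_T \<kappa> mult_right_mono abs_cas_le)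
      finally show ?thesis by (simp add: mean_cmult D_def)
    qed
    then have "\<bar>\<gamma> k\<bar> * \<bar>mean (\<lambda>t. cas k t * \<kappa> t)\<bar> \<le> s * L * (2 * D)" if "k \<in> K" for k
      using \<gamma>_le[OF that] s L by (intro mult_mono) simp_all
    then have "\<gamma> k * mean (\<lambda>t. cas k t * \<kappa> t) \<le> s * L * (2 * D)" if "k \<in> K" for k
      using that abs_ge_self[of "\<gamma> k * mean (\<lambda>t. cas k t * \<kappa> t)"] unfolding abs_mult by fastforce
    then have "(\<Sum>k\<in>K. \<gamma> k * mean (\<lambda>t. cas k t * \<kappa> t)) \<le> (\<Sum>k\<in>K. s * L * (2 * D))"
      by (rule sum_mono)
    also have "\<dots> \<le> s * R * D" using s D0 by (simp add: R_def algebra_simps)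
    finally show ?thesis .
  qed
  moreover have "mean (\<lambda>t. g' t * \<kappa> t) = mean (\<lambda>t. g' t * w t)"
  proof -
    have "mean (\<lambda>t. g' t * \<kappa> t) = mean (\<lambda>t. g' t * w t) - mean (\<lambda>t. g' t * \<tau> t)"
      unfolding \<kappa>_def right_diff_distrib
      by (intro mean_diff Linf_T_mult g' w trig_poly_in_Linf_T[OF \<tau>])
    then show ?thesis using trig_poly_perp_mean_eq_0[OF perp \<tau>] by simp
  qed
  moreover have "mean (\<lambda>t. g' t * w t) \<le> C * (1 + s * R)"
    by (rule dual[OF perp g'_le])
  ultimately have main: "D * (1 - s * R) \<le> C * (1 + s * R) + \<epsilon>"
    using proj_pair[OF \<kappa>] by (simp add: algebra_simps)
  have "s * R \<le> \<epsilon> / (2 * C + 2 * \<epsilon>)" unfolding sR by simp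
  then have "s * R * (2 * C + 2 * \<epsilon>) \<le> \<epsilon>" using C \<epsilon> by (simp add: pos_le_divide_eq)
  then have "C * (1 + s * R) + \<epsilon> \<le> (C + 2 * \<epsilon>) * (1 - s * R)" by (simp add: algebra_simps)
  then have "D * (1 - s * R) \<le> (C + 2 * \<epsilon>) * (1 - s * R)" using main by linarith
  moreover have "1 - s * R > 0" unfolding sR by linarith
  ultimately have "D \<le> C + 2 * \<epsilon>" by simp
  then show ?thesis using \<tau> by (auto simp: D_def \<kappa>_def)
qed

section \<open>Strict contraction on the annihilator\<close>

text \<open>
  On the frequency \<open>k\<close> the sum is geometric with ratio \<open>z = - cis (\<pi> k / n)\<close>. This ratio is a \<open>2 n\<close>-th root of
  unity, and \<open>\<bar>k\<bar> < n\<close> keeps it different from 1.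
\<close>

lemma alternating_sum_trig_poly:
  assumes n: "n \<ge> 1" and \<tau>: "\<tau> \<in> trig_poly n"
  shows "(\<Sum>m<2 * n. (-1) ^ m * \<tau> (x + real m / (2 * real n))) = 0"
  using \<tau>
proof (induction rule: trig_poly_induct)
  case (cas k)
  define \<theta> where "\<theta> = pi * of_int k / real n"
  define z where "z = - cis \<theta>"
  have "z \<noteq> 1"
  proof
    assume "z = 1"
    then have "cis \<theta> = -1" by (metis minus_minus z_def)
    then have "cos \<theta> = -1" by (metis cis.sel(1) uminus_complex.sel(1) one_complex.sel(1))
    moreover have "cos pi < cos \<bar>\<theta>\<bar>"
    proof (rule cos_monotone_0_pi)
      have "\<bar>of_int k\<bar> < real n" using cas by auto
      then show "\<bar>\<theta>\<bar> < pi" using n by (simp add: \<theta>_def abs_mult field_simps)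
    qed auto
    ultimately show False by simp
  qed
  moreover have "z ^ (2 * n) = 1"
  proof -
    have "z ^ (2 * n) = cis \<theta> ^ (2 * n)" by (simp add: z_def)
    also have "\<dots> = cis (2 * pi * of_int k)" using n by (simp add: Complex.DeMoivre \<theta>_def mult_ac)
    finally show ?thesis by simp
  qed
  ultimately have "(\<Sum>m<2 * n. z ^ m) = 0" by (simp add: geometric_sum)
  have expand: "cis (2 * pi * of_int k * x) * z ^ m
      = of_real ((-1) ^ m) * cis (2 * pi * of_int k * (x + real m / (2 * real n)))" for m
  proof -
    have "2 * pi * of_int k * (x + real m / (2 * real n)) = 2 * pi * of_int k * x + real m * \<theta>"
      using n by (simp add: \<theta>_def field_simps)
    moreover have "z ^ m = (-1) ^ m * cis (real m * \<theta>)"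
      unfolding z_def by (subst power_minus) (simp add: Complex.DeMoivre)
    ultimately show ?thesis by (simp add: cis_mult[symmetric])
  qed
  have *: "(\<Sum>m<2 * n. of_real ((-1) ^ m) * cis (2 * pi * of_int k * (x + real m / (2 * real n)))) = 0"
  proof -
    have "(\<Sum>m<2 * n. cis (2 * pi * of_int k * x) * z ^ m) = 0"
      using \<open>(\<Sum>m<2 * n. z ^ m) = 0\<close> by (simp flip: sum_distrib_left)
    then show ?thesis by (simp only: expand)
  qed
  have "(-1) ^ m * cas k y = Re (of_real ((-1) ^ m) * cis (2 * pi * of_int k * y))
      + Im (of_real ((-1) ^ m) * cis (2 * pi * of_int k * y))" for m y
    by (simp add: cas_def distrib_left)
  then show ?case
    using arg_cong[OF *, of Re] arg_cong[OF *, of Im] by (simp only: sum.distrib Re_sum Im_sum) simp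
next
  case (add \<sigma> \<tau>)
  then show ?case by (simp add: distrib_left sum.distrib)
next
  case (cmult c \<tau>)
  then show ?case by (simp add: mult.left_commute[of _ c] flip: sum_distrib_left)
qed simp

text \<open>
  Translating by \<open>m / (2 n)\<close> does not change the mean and turns \<open>s\<close> into \<open>(-1)\<^sup>m s\<close>; averaging over
  \<open>m < 2 n\<close> leaves the alternating sum of \<open>\<tau>\<close>, which vanishes.
\<close>

lemma mean_antiperiodic_mult_trig_poly:
  assumes n: "n \<ge> 1" and s: "s \<in> Linf_T" and anti: "\<And>x. s (x + 1 / (2 * real n)) = - s x"
    and \<tau>: "\<tau> \<in> trig_poly n"
  shows "mean (\<lambda>x. s x * \<tau> x) = 0"
proof -
  have s_shift: "s (x + real m / (2 * real n)) = (-1) ^ m * s x" for m x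
  proof (induction m)
    case (Suc m)
    have "x + real (Suc m) / (2 * real n) = x + real m / (2 * real n) + 1 / (2 * real n)"
      by (simp add: add_divide_distrib)
    then show ?case using anti[of "x + real m / (2 * real n)"] Suc by (simp only: power_Suc)
  qed simp
  have st: "(\<lambda>x. s x * \<tau> x) \<in> Linf_T"
    by (intro Linf_T_mult s trig_poly_in_Linf_T[OF \<tau>])
  have term_in: "(\<lambda>x. (-1) ^ m * (s x * \<tau> (x + real m / (2 * real n)))) \<in> Linf_T" for m
    by (intro Linf_T_cmult Linf_T_mult s trig_poly_in_Linf_T[OF trig_poly_shift[OF \<tau>]])
  have "mean (\<lambda>x. (-1) ^ m * (s x * \<tau> (x + real m / (2 * real n)))) = mean (\<lambda>x. s x * \<tau> x)" for m
    using mean_shift[OF st, of "real m / (2 * real n)"] s_shift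
    by (simp add: add.commute[of "real m / (2 * real n)"] mult.assoc)
  then have "real (2 * n) * mean (\<lambda>x. s x * \<tau> x)
      = (\<Sum>m<2 * n. mean (\<lambda>x. (-1) ^ m * (s x * \<tau> (x + real m / (2 * real n)))))" by simp
  also have "\<dots> = mean (\<lambda>x. \<Sum>m<2 * n. (-1) ^ m * (s x * \<tau> (x + real m / (2 * real n))))"
    by (rule mean_sum[symmetric]) (rule term_in)
  also have "\<dots> = mean (\<lambda>x. s x * (\<Sum>m<2 * n. (-1) ^ m * \<tau> (x + real m / (2 * real n))))"
    by (simp add: sum_distrib_left mult.left_commute)
  also have "\<dots> = 0"
    by (simp add: alternating_sum_trig_poly[OF n \<tau>] mean_const)
  finally show ?thesis using n by simp
qed

definition square_wave :: "nat \<Rightarrow> real \<Rightarrow> real" where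
  "square_wave n x = sgn (sin (2 * pi * real n * x))"

lemma square_wave_in_Linf_T: "square_wave n \<in> Linf_T"
proof -
  have "(\<lambda>x. sin (2 * pi * real n * x)) \<in> Linf_T"
    using cos_sin_in_Linf_T(2)[of "int n"] by simp
  then show ?thesis
    unfolding square_wave_def[abs_def]
    by (rule Linf_T_compose[where \<phi> = sgn and a = 1 and b = 0]) (auto simp: sgn_if)
qed

lemma square_wave_antiperiodic:
  assumes "n \<ge> 1" shows "square_wave n (x + 1 / (2 * real n)) = - square_wave n x"
proof -
  have "2 * pi * real n * (x + 1 / (2 * real n)) = 2 * pi * real n * x + pi"
    using assms by (simp add: field_simps)
  then show ?thesis by (simp add: square_wave_def sgn_minus)
qed

definition dirichlet :: "nat \<Rightarrow> real \<Rightarrow> real" where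
  "dirichlet n x = (\<Sum>j<n. (if j = 0 then 1 else 2) * cos (2 * pi * real j * x))"

lemma dirichlet_in_trig_poly: "dirichlet n \<in> trig_poly n"
  unfolding trig_poly_def dirichlet_def[abs_def]
  by (intro CollectI exI[of _ "\<lambda>j. if j = 0 then 1 else 2"] exI[of _ "\<lambda>_. 0"]) simp

lemma sin_mult_dirichlet: "n \<ge> 1 \<Longrightarrow> sin (pi * x) * dirichlet n x = sin ((2 * real n - 1) * (pi * x))"
proof (induction n rule: nat_induct_at_least)
  case base
  then show ?case by (simp add: dirichlet_def)
next
  case (Suc n)
  have "sin (pi * x) * dirichlet (Suc n) x
      = sin ((2 * real n - 1) * (pi * x)) + 2 * (sin (pi * x) * cos (2 * pi * real n * x))"
    using Suc by (simp add: dirichlet_def distrib_left)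
  also have "\<dots> = sin (2 * pi * real n * x + pi * x)"
  proof -
    have "(2 * real n - 1) * (pi * x) = 2 * pi * real n * x - pi * x" by (simp add: algebra_simps)
    then show ?thesis by (simp add: sin_add sin_diff)
  qed
  also have "2 * pi * real n * x + pi * x = (2 * real (Suc n) - 1) * (pi * x)"
    by (simp add: algebra_simps)
  finally show ?case .
qed

text \<open>
  With \<open>a = 1 / (2 n)\<close>, this polynomial of degree at most \<open>n - 1\<close> is a multiple of
  \<open>sin (2 \<pi> n x) / (sin (\<pi> x) sin (\<pi> (x - a)))\<close>: of the \<open>2 n\<close> equally spaced sign changes of \<open>sin (2 \<pi> n x)\<close>
  in a period, those at \<open>0\<close> and \<open>a\<close> are removed. It is the test function that detects mass
  concentrated on an interval longer than \<open>a\<close>.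
\<close>

definition bump :: "nat \<Rightarrow> real \<Rightarrow> real" where
  "bump n x = dirichlet n x + dirichlet n (x + - (1 / (2 * real n)))"

lemma bump_in_trig_poly: "bump n \<in> trig_poly n"
  unfolding bump_def[abs_def]
  by (intro trig_poly_add trig_poly_shift dirichlet_in_trig_poly)

lemma bump_sin_identity:
  assumes n: "n \<ge> 1"
  shows "bump n x * (sin (pi * x) * sin (pi * (x - 1 / (2 * real n))))
       = - (sin (pi / (2 * real n)) * sin (2 * pi * real n * x))"
proof -
  define y where "y = x - 1 / (2 * real n)"
  define u where "u = 2 * pi * real n * x"
  have px: "(2 * real n - 1) * (pi * x) = u - pi * x" by (simp add: u_def algebra_simps)
  have py: "(2 * real n - 1) * (pi * y) = (u - pi * y) - pi"
    using n by (simp add: u_def y_def field_simps)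
  have "bump n x * (sin (pi * x) * sin (pi * y))
      = (sin (pi * x) * dirichlet n x) * sin (pi * y) + (sin (pi * y) * dirichlet n y) * sin (pi * x)"
    by (simp add: bump_def y_def algebra_simps)
  also have "\<dots> = sin (u - pi * x) * sin (pi * y) - sin (u - pi * y) * sin (pi * x)"
    unfolding sin_mult_dirichlet[OF n] px py by simp
  also have "\<dots> = - (sin u * sin (pi * x - pi * y))"
    by (simp add: sin_diff algebra_simps)
  also have "pi * x - pi * y = pi / (2 * real n)" by (simp add: y_def algebra_simps)
  finally show ?thesis by (simp add: y_def u_def mult.commute)
qed

text \<open>
  Beyond \<open>a = 1 / (2 n)\<close> the bump has the sign opposite to the square wave, whereas on \<open>(0, a)\<close> the
  signs agree. Since the square wave is orthogonal to the bump, the integral of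
  \<open>\<bar>bump\<bar>\<close> over \<open>(0, a)\<close> equals that over \<open>(a, 1)\<close>.
\<close>

lemma bump_sign:
  assumes n: "n \<ge> 1" and x: "1 / (2 * real n) < x" "x < 1"
  shows "square_wave n x * bump n x = - \<bar>bump n x\<bar>"
    and "sin (2 * pi * real n * x) < 0 \<Longrightarrow> bump n x > 0"
proof -
  define P where "P = sin (pi * x) * sin (pi * (x - 1 / (2 * real n)))"
  define c where "c = sin (pi / (2 * real n))"
  define S where "S = sin (2 * pi * real n * x)"
  have a: "0 < 1 / (2 * real n)" using n by simp
  have "sin (pi * y) > 0" if "0 < y" "y < 1" for y
    using that by (intro sin_gt_zero) simp_all
  from this[of x] this[of "x - 1 / (2 * real n)"] have "P > 0"
    using a x unfolding P_def by (intro mult_pos_pos) linarith+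
  have "c > 0" unfolding c_def
  proof (rule sin_gt_zero)
    have "pi < pi * (2 * real n)" using n by simp
    then show "pi / (2 * real n) < pi" using n by (simp add: divide_less_eq)
  qed (use n in simp)
  have eq: "bump n x = - (c / P) * S"
    using bump_sin_identity[OF n, of x] \<open>P > 0\<close> unfolding P_def[symmetric] c_def[symmetric] S_def[symmetric]
    by (simp add: field_simps)
  have cP: "c / P > 0" using \<open>c > 0\<close> \<open>P > 0\<close> by simp
  show "square_wave n x * bump n x = - \<bar>bump n x\<bar>"
    using \<open>c > 0\<close> \<open>P > 0\<close> unfolding square_wave_def S_def[symmetric] eq
    by (auto simp: sgn_if abs_mult)
  show "bump n x > 0" if "sin (2 * pi * real n * x) < 0"
    using mult_pos_neg[OF cP, of S] that by (simp add: eq S_def)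
qed

lemma mean_eq_integral_unit_interval:
  "mean p = (LINT t:{0..1}|lebesgue. p (-1/2 + t))"
  unfolding mean_def set_lebesgue_integral_def
  by (subst lebesgue_integral_shift[where a = "-1/2"])
     (auto intro!: Bochner_Integration.integral_cong simp: indicator_def)

lemma mean_eq_integral_0_1:
  assumes "p \<in> Linf_T" shows "mean p = (LINT t:{0..1}|lebesgue. p t)"
proof -
  have "mean p = mean (\<lambda>t. p (1/2 + t))" by (rule mean_shift[OF assms, symmetric])
  then show ?thesis by (simp add: mean_eq_integral_unit_interval)
qed

text \<open>
  Twice the mass of the bump on \<open>(a, b)\<close>, where \<open>a = 1 / (2 n)\<close> and \<open>b \<le> 2 a\<close>. On \<open>(0, a)\<close> the square wave is 1 and
  the integrand vanishes; on \<open>(a, 2 a)\<close> it is \<open>-1\<close> and the bump is positive.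
\<close>

lemma mass_defect_pos:
  assumes n: "n \<ge> 1" and b: "1 / (2 * real n) < b" "b \<le> 1 / real n"
  shows "(LINT t:{0<..<b}|lebesgue. (1 - square_wave n t) * bump n t) > 0"
proof -
  define a where "a = 1 / (2 * real n)"
  have a: "0 < a" "a < b" "b \<le> 2 * a" "2 * a \<le> 1" using n b by (auto simp: a_def)
  define p where "p t = (1 - square_wave n t) * bump n t" for t
  define F where "F t = indicator {0<..<b} t *\<^sub>R p t" for t
  have "p \<in> Linf_T" unfolding p_def[abs_def]
    by (intro Linf_T_intros square_wave_in_Linf_T trig_poly_in_Linf_T[OF bump_in_trig_poly])
  then have intF: "integrable lebesgue F"
    using Linf_T_set_integrable[of p "{0<..<b}"] by (simp add: F_def[abs_def] set_integrable_def)
  have zero: "p t = 0" if "0 < t" "t < a" for t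
  proof -
    have "2 * pi * real n * t < pi" using that n by (simp add: a_def field_simps)
    then have "sin (2 * pi * real n * t) > 0" using that n by (intro sin_gt_zero) auto
    then show ?thesis by (simp add: p_def square_wave_def)
  qed
  have pos: "p t > 0" if "a < t" "t < b" for t
  proof -
    have "sin (2 * pi * real n * t - pi) > 0"
    proof (rule sin_gt_zero)
      have "2 * real n * t > 1" using that n by (simp add: a_def field_simps)
      then have "pi * (2 * real n * t) > pi * 1" by (intro mult_strict_left_mono) auto
      then show "0 < 2 * pi * real n * t - pi" by (simp add: mult_ac)
      have "t < 2 * a" using that a by linarith
      then have "2 * real n * t < 2" using n by (simp add: a_def field_simps)
      then have "pi * (2 * real n * t) < pi * 2" by (intro mult_strict_left_mono) auto
      then show "2 * pi * real n * t - pi < pi" by (simp add: mult_ac)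
    qed
    then have neg: "sin (2 * pi * real n * t) < 0" by (simp add: sin_diff)
    have "1 / (2 * real n) < t" "t < 1" using that a by (auto simp: a_def[symmetric])
    from bump_sign(2)[OF n this neg] neg show ?thesis by (simp add: p_def square_wave_def)
  qed
  have "AE t in lebesgue. t \<noteq> a" by (intro AE_completion AE_lborel_singleton)
  then have nonneg: "AE t in lebesgue. 0 \<le> F t"
  proof eventually_elim
    case (elim t)
    then show ?case
      using zero[of t] pos[of t] by (cases "t < a") (auto simp: F_def indicator_def)
  qed
  have "integral\<^sup>L lebesgue F \<noteq> 0"
  proof
    assume "integral\<^sup>L lebesgue F = 0"
    then have "AE t in lebesgue. F t = 0"
      using integral_nonneg_eq_0_iff_AE[OF intF nonneg] by simp
    then have "AE t in lebesgue. t \<notin> {a<..<b}"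
    proof eventually_elim
      case (elim t)
      then show ?case using pos[of t] a by (auto simp: F_def indicator_def split: if_splits)
    qed
    then have "negligible {a<..<b}"
      by (simp add: negligible_iff_null_sets AE_iff_null_sets)
    then show False using a open_not_negligible[of "{a<..<b}"] by auto
  qed
  moreover have "integral\<^sup>L lebesgue F \<ge> 0" by (rule integral_nonneg_AE[OF nonneg])
  ultimately have "integral\<^sup>L lebesgue F > 0" by linarith
  then show ?thesis by (simp add: set_lebesgue_integral_def F_def[abs_def] p_def)
qed

text \<open>
  Suppose that \<open>\<bar>g\<bar> \<le> M\<close> and that \<open>g\<close> is close to \<open>M\<close> on an interval of length \<open>b > a\<close>, where
  \<open>a = 1 / (2 n)\<close>. After a translation this interval is \<open>(0, b)\<close>. The integral of \<open>g \<sqdot> bump\<close> over it is then close to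
  \<open>M\<close> times the mass of the bump on \<open>(0, b)\<close>, and for \<open>b > a\<close> this mass exceeds the mass of \<open>\<bar>bump\<bar>\<close> on the rest of the period by
  \<open>\<rho> > 0\<close>. So the rest of the period cannot compensate, and \<open>g\<close> is not orthogonal to the bump.
  Quantitatively, the integral of \<open>g\<close> over \<open>(0, b)\<close> is at most \<open>M (b - \<rho> / B)\<close>, where \<open>B\<close> bounds the
  bump. Taking \<open>b \<le> 2 a\<close> keeps the bump nonnegative on \<open>(0, b)\<close>; if \<open>h\<close> is larger, the remaining part of the
  interval contributes at most \<open>M (h - b)\<close>. The condition \<open>h > a\<close> is sharp for this argument: for \<open>h = a\<close> the
  square wave is orthogonal to \<open>trig_poly n\<close> and has mean 1 on an interval of length \<open>h\<close>.
\<close>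

lemma convol_chi_strict_contraction:
  assumes n: "n \<ge> 1" and h: "h > 1 / (2 * real n)"
  shows "\<exists>q<1. \<forall>g\<in>trig_poly_perp n. \<forall>x. \<bar>convol g (chi h) x\<bar> \<le> q * Linf_norm g"
proof -
  define a where "a = 1 / (2 * real n)"
  define b where "b = min h (1 / real n)"
  have a: "0 < a" using n by (simp add: a_def)
  have h0: "h > 0" using h a unfolding a_def by linarith
  have b: "1 / (2 * real n) < b" "b \<le> 1 / real n" "b \<le> h"
    using n h by (auto simp: b_def field_simps)
  have "1 / real n \<le> 1" using n by simp
  then have b1: "0 < b" "b \<le> 1" using b a unfolding a_def by linarith+
  define \<rho> where "\<rho> = (LINT t:{0<..<b}|lebesgue. (1 - square_wave n t) * bump n t)"
  have \<rho>: "\<rho> > 0" unfolding \<rho>_def by (rule mass_defect_pos[OF n b(1,2)])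
  obtain B where B: "\<And>x. \<bar>bump n x\<bar> \<le> B" "B > 0"
    using trig_poly_bounded[OF bump_in_trig_poly] by blast
  have bmp: "bump n \<in> Linf_T" by (rule trig_poly_in_Linf_T[OF bump_in_trig_poly])
  define q where "q = 1 - \<rho> / (B * h)"
  have one_sided: "convol g (chi h) x \<le> q * M"
    if g: "g \<in> trig_poly_perp n" and M: "AE t in lebesgue. \<bar>g t\<bar> \<le> M" for g x M
  proof -
    define G where "G t = g (x - h / 2 + t)" for t
    have Gp: "G \<in> trig_poly_perp n"
      unfolding G_def[abs_def] by (rule trig_poly_perp_shift[OF g])
    have G: "G \<in> Linf_T" by (rule trig_poly_perp_in_Linf_T[OF Gp])
    have GM: "AE t in lebesgue. \<bar>G t\<bar> \<le> M"
      unfolding G_def by (rule AE_lebesgue_shift[OF M])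
    \<comment> \<open>The function p has mean 0, and it is at most r on (0, b) and at most 0 on the rest of
        the unit interval. Hence the integral of r over (0, b) is nonnegative, and this is
        the desired estimate.\<close>
    define p where "p t = M * (square_wave n t * bump n t) - G t * bump n t" for t
    define r where "r t = B * (M - G t) - M * ((1 - square_wave n t) * bump n t)" for t
    have p: "p \<in> Linf_T" unfolding p_def[abs_def]
      by (intro Linf_T_intros square_wave_in_Linf_T bmp G)
    have r: "r \<in> Linf_T" unfolding r_def[abs_def]
      by (intro Linf_T_intros square_wave_in_Linf_T bmp G)
    have sb: "(\<lambda>t. M * (square_wave n t * bump n t)) \<in> Linf_T" "(\<lambda>t. G t * bump n t) \<in> Linf_T"
      by (intro Linf_T_intros square_wave_in_Linf_T bmp G)+
    have "mean p = 0"
      unfolding p_def[abs_def] mean_diff[OF sb] mean_cmult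
      using trig_poly_perp_mean_eq_0[OF Gp bump_in_trig_poly]
        mean_antiperiodic_mult_trig_poly[OF n square_wave_in_Linf_T square_wave_antiperiodic[OF n] bump_in_trig_poly]
      by simp
    then have "0 = (LINT t:{0..1}|lebesgue. p t)" by (simp add: mean_eq_integral_0_1[OF p])
    also have "\<dots> \<le> (LINT t:{0<..<b}|lebesgue. r t)"
      unfolding set_lebesgue_integral_def
    proof (rule integral_mono_AE)
      show "integrable lebesgue (\<lambda>t. indicator {0..1} t *\<^sub>R p t)"
        "integrable lebesgue (\<lambda>t. indicator {0<..<b} t *\<^sub>R r t)"
        using Linf_T_set_integrable[OF p, of "{0..1}"] Linf_T_set_integrable[OF r, of "{0<..<b}"]
        by (simp_all add: set_integrable_def)
      have "AE t in lebesgue. t \<noteq> (0::real)" "AE t in lebesgue. t \<noteq> (1::real)"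
        by (intro AE_completion AE_lborel_singleton)+
      then show "AE t in lebesgue. indicator {0..1} t *\<^sub>R p t \<le> indicator {0<..<b} t *\<^sub>R r t"
        using GM
      proof eventually_elim
        case (elim t)
        consider "t \<in> {0<..<b}" | "t \<notin> {0..1}" "t \<notin> {0<..<b}" | "b \<le> t" "t < 1"
          using elim b1 by fastforce
        then show ?case
        proof cases
          case 1
          have "(M - G t) * bump n t \<le> (M - G t) * B"
            using elim B(1)[of t] by (intro mult_left_mono) auto
          then have "p t \<le> r t" by (simp add: p_def r_def algebra_simps)
          then show ?thesis using 1 b1 by simp
        next
          case 2
          then show ?thesis by simp
        next
          case 3
          have "- G t * bump n t \<le> M * \<bar>bump n t\<bar>"
            using mult_right_mono[OF elim(3), of "\<bar>bump n t\<bar>"] abs_ge_self[of "- G t * bump n t"]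
            by (simp add: abs_mult)
          moreover have "square_wave n t * bump n t = - \<bar>bump n t\<bar>"
            using 3 b by (intro bump_sign(1)[OF n]) auto
          ultimately have "p t \<le> 0" by (simp add: p_def)
          then show ?thesis using 3 b1 by simp
        qed
      qed
    qed
    also have "\<dots> = B * (M * b - (LINT t:{0<..<b}|lebesgue. G t)) - M * \<rho>"
    proof -
      have J: "set_integrable lebesgue {0<..<b} v" if "v \<in> Linf_T" for v
        by (rule Linf_T_set_integrable[OF that]) auto
      have "(LINT t:{0<..<b}|lebesgue. r t) =
          (LINT t:{0<..<b}|lebesgue. B * (M - G t)) - (LINT t:{0<..<b}|lebesgue. M * ((1 - square_wave n t) * bump n t))"
        unfolding r_def by (intro set_integral_diff J Linf_T_intros square_wave_in_Linf_T bmp G)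
      also have "(LINT t:{0<..<b}|lebesgue. B * (M - G t)) = B * (LINT t:{0<..<b}|lebesgue. M - G t)"
        by simp
      also have "(LINT t:{0<..<b}|lebesgue. M - G t)
          = (LINT t:{0<..<b}|lebesgue. M) - (LINT t:{0<..<b}|lebesgue. G t)"
        by (intro set_integral_diff J Linf_T_const G)
      also have "(LINT t:{0<..<b}|lebesgue. M) = M * b"
        using b1 by (simp add: set_lebesgue_integral_def)
      finally show ?thesis by (simp add: \<rho>_def)
    qed
    finally have "B * (LINT t:{0<..<b}|lebesgue. G t) \<le> B * (M * b) - M * \<rho>"
      by (simp add: algebra_simps)
    then have near: "(LINT t:{0<..<b}|lebesgue. G t) \<le> M * b - M * \<rho> / B"
      using B(2) by (simp add: field_simps)
    have far: "(LINT t:{b..<h}|lebesgue. G t) \<le> M * (h - b)"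
    proof -
      have "(LINT t:{b..<h}|lebesgue. G t) \<le> (LINT t:{b..<h}|lebesgue. M)"
      proof (rule set_integral_mono_AE)
        show "AE t\<in>{b..<h} in lebesgue. G t \<le> M" using GM by eventually_elim auto
      qed (auto intro: Linf_T_set_integrable[OF G] Linf_T_set_integrable[OF Linf_T_const])
      then show ?thesis using b by (simp add: set_lebesgue_integral_def mult.commute)
    qed
    have "(LINT t:{0<..<h}|lebesgue. G t) = (LINT t:{0<..<b} \<union> {b..<h}|lebesgue. G t)"
      using b b1 by (intro arg_cong[where f = "\<lambda>S. LINT t:S|lebesgue. G t"]) auto
    also have "\<dots> = (LINT t:{0<..<b}|lebesgue. G t) + (LINT t:{b..<h}|lebesgue. G t)"
      by (rule set_integral_Un) (auto intro: Linf_T_set_integrable[OF G])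
    also have "\<dots> \<le> M * (h - \<rho> / B)" using near far by (simp add: algebra_simps)
    finally have "(LINT t:{0<..<h}|lebesgue. G t) / h \<le> M * (h - \<rho> / B) / h"
      using h0 by (intro divide_right_mono) auto
    also have "\<dots> = q * M" using h0 B(2) by (simp add: q_def field_simps)
    finally show ?thesis by (simp add: convol_chi_eq_set_integral[OF h0] G_def)
  qed
  have "\<bar>convol g (chi h) x\<bar> \<le> q * Linf_norm g" if g: "g \<in> trig_poly_perp n" for g x
  proof -
    have M: "AE t in lebesgue. \<bar>g t\<bar> \<le> Linf_norm g"
      by (rule Linf_T_AE_le_norm[OF trig_poly_perp_in_Linf_T[OF g]])
    have "convol g (chi h) x \<le> q * Linf_norm g" by (rule one_sided[OF g M])
    moreover have "convol (\<lambda>t. - g t) (chi h) x \<le> q * Linf_norm g"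
      by (rule one_sided[OF trig_poly_perp_uminus[OF g]]) (use M in simp)
    moreover have "convol (\<lambda>t. - g t) (chi h) x = - convol g (chi h) x"
      by (simp add: convol_def)
    ultimately show ?thesis by linarith
  qed
  moreover have "q < 1" using \<rho> B(2) h0 by (simp add: q_def)
  ultimately show ?thesis by blast
qed

section \<open>The constant and the approximation estimate\<close>

lemma Linf_norm_pos:
  assumes "g \<in> Linf_T" "\<not> (AE x in lebesgue. g x = 0)"
  shows "Linf_norm g > 0"
proof (rule ccontr)
  assume "\<not> Linf_norm g > 0"
  then have "AE x in lebesgue. g x = 0"
    using Linf_T_AE_le_norm[OF assms(1)] by (auto elim!: eventually_mono)
  then show False using assms(2) by simp
qed

lemma cas_not_AE_zero: "\<not> (AE x in lebesgue. cas k x = 0)"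
proof
  assume "AE x in lebesgue. cas k x = 0"
  then have "\<bar>cas k 0\<bar> \<le> 0"
    by (intro continuous_abs_le_of_AE continuous_on_cas) (auto elim!: eventually_mono)
  then show False by (simp add: cas_def)
qed

text \<open>
  By the strict contraction all quotients are at most some \<open>q < 1\<close>, so their supremum is a genuine one. Functions
  \<open>g\<close> that vanish almost everywhere have no quotient; for them the contraction bound itself shows that the
  convolution has norm 0.
\<close>

lemma c_const_properties:
  assumes n: "n \<ge> 1" and h: "h > 1 / (2 * real n)"
  shows c_const_less_1: "c_const h n < 1"
    and c_const_nonneg: "0 \<le> c_const h n"
    and Linf_norm_convol_le_c_const:
      "g \<in> trig_poly_perp n \<Longrightarrow> Linf_norm (convol g (chi h)) \<le> c_const h n * Linf_norm g"
proof -
  define P where "P = {g \<in> trig_poly_perp n. \<not> (AE x in lebesgue. g x = 0)}"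
  have "0 < 1 / (2 * real n)" using n by simp
  then have h0: "h > 0" using h by linarith
  have c: "c_const h n = (SUP g\<in>P. Linf_norm (convol g (chi h)) / Linf_norm g)"
    by (simp add: c_const_def P_def)
  obtain q where q: "q < 1" "\<And>g x. g \<in> trig_poly_perp n \<Longrightarrow> \<bar>convol g (chi h) x\<bar> \<le> q * Linf_norm g"
    using convol_chi_strict_contraction[OF n h] by blast
  have norm_pos: "Linf_norm g > 0" if "g \<in> P" for g
    using that by (auto simp: P_def intro: Linf_norm_pos trig_poly_perp_in_Linf_T)
  have quot: "Linf_norm (convol g (chi h)) / Linf_norm g \<le> q" if g: "g \<in> P" for g
  proof -
    have gp: "g \<in> trig_poly_perp n" using g by (simp add: P_def)
    have "Linf_norm (convol g (chi h)) \<le> q * Linf_norm g"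
      using q(2)[OF gp]
      by (intro Linf_norm_le Linf_T_measurable convol_chi_in_Linf_T[OF h0 trig_poly_perp_in_Linf_T[OF gp]]) auto
    then show ?thesis using norm_pos[OF g] by (simp add: pos_divide_le_eq)
  qed
  have wit: "cas (int n) \<in> P"
    by (simp add: P_def cas_in_trig_poly_perp cas_not_AE_zero)
  have bdd: "bdd_above ((\<lambda>g. Linf_norm (convol g (chi h)) / Linf_norm g) ` P)"
    by (rule bdd_aboveI2) (rule quot)
  have "c_const h n \<le> q" unfolding c using wit by (intro cSUP_least quot) auto
  then show "c_const h n < 1" using q(1) by simp
  show c0: "0 \<le> c_const h n" unfolding c
    by (rule cSUP_upper2[OF bdd wit]) (simp add: Linf_norm_nonneg)
  show "Linf_norm (convol g (chi h)) \<le> c_const h n * Linf_norm g" if g: "g \<in> trig_poly_perp n"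
  proof (cases "g \<in> P")
    case True
    have "Linf_norm (convol g (chi h)) / Linf_norm g \<le> c_const h n"
      unfolding c by (rule cSUP_upper[OF True bdd])
    then show ?thesis using norm_pos[OF True] by (simp add: pos_divide_le_eq)
  next
    case False
    then have "AE x in lebesgue. g x = 0" using g by (simp add: P_def)
    then have "Linf_norm g \<le> 0"
      by (intro Linf_norm_le Linf_T_measurable trig_poly_perp_in_Linf_T[OF g]) (auto elim!: eventually_mono)
    then have z: "Linf_norm g = 0" using Linf_norm_nonneg[of g] by linarith
    then have "Linf_norm (convol g (chi h)) \<le> 0"
      using q(2)[OF g]
      by (intro Linf_norm_le Linf_T_measurable convol_chi_in_Linf_T[OF h0 trig_poly_perp_in_Linf_T[OF g]]) auto
    then show ?thesis using z by simp
  qed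
qed

text \<open>
  The pairing of \<open>g\<close> with the periodized kernel is the value of \<open>g * \<chi>\<^sub>h\<close> at 0, so the
  dual bound of \<open>L1_distance_le_dual_bound\<close> holds with the constant \<open>c_const h n\<close>.
\<close>

lemma periodized_chi_L1_approximation:
  assumes n: "n \<ge> 1" and h: "h > 1 / (2 * real n)" and \<epsilon>: "\<epsilon> > 0"
  shows "\<exists>\<tau>\<in>trig_poly n. mean (\<lambda>t. \<bar>periodized_chi h t - \<tau> t\<bar>) \<le> c_const h n + 2 * \<epsilon>"
proof (rule L1_distance_le_dual_bound[OF _ c_const_nonneg[OF n h] \<epsilon>])
  have "0 < 1 / (2 * real n)" using n by simp
  then have h0: "h > 0" using h by linarith
  show "periodized_chi h \<in> Linf_T" by (rule periodized_chi_in_Linf_T[OF h0])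
  fix g M assume g: "g \<in> trig_poly_perp n" and M: "\<And>t. \<bar>g t\<bar> \<le> M"
  have gL: "g \<in> Linf_T" by (rule trig_poly_perp_in_Linf_T[OF g])
  have "mean (\<lambda>t. g t * periodized_chi h t) = convol g (chi h) 0"
    by (simp add: convol_chi_eq_mean[OF h0 gL])
  also have "\<dots> \<le> \<bar>convol g (chi h) 0\<bar>" by simp
  also have "\<dots> \<le> Linf_norm (convol g (chi h))"
    by (rule continuous_abs_le_Linf_norm[OF convol_chi_in_Linf_T[OF h0 gL] convol_chi_continuous[OF h0 gL]])
  also have "\<dots> \<le> c_const h n * Linf_norm g"
    by (rule Linf_norm_convol_le_c_const[OF n h g])
  also have "\<dots> \<le> c_const h n * M"
    using M by (intro mult_left_mono c_const_nonneg[OF n h] Linf_norm_le Linf_T_measurable[OF gL]) auto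
  finally show "mean (\<lambda>t. g t * periodized_chi h t) \<le> c_const h n * M" .
qed

lemma best_approx_le: "\<tau> \<in> trig_poly n \<Longrightarrow> best_approx n f \<le> Linf_norm (\<lambda>x. f x - \<tau> x)"
  unfolding best_approx_def by (rule cINF_lower) (auto intro: bdd_belowI2 Linf_norm_nonneg)

lemma best_approx_greatest:
  "(\<And>\<tau>. \<tau> \<in> trig_poly n \<Longrightarrow> m \<le> Linf_norm (\<lambda>x. f x - \<tau> x)) \<Longrightarrow> m \<le> best_approx n f"
  unfolding best_approx_def using trig_poly_zero by (intro cINF_greatest) auto

lemma C_T_in_Linf_T: "f \<in> C_T \<Longrightarrow> f \<in> Linf_T"
  by (rule Linf_T_continuous)
     (auto simp: C_T_def periodic_fun_simple'_def dest: periodic_fun.plus_1)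

lemma W2_upper:
  assumes h: "h > 0" and f: "f \<in> C_T"
  shows "\<bar>f x - convol f (chi h) x\<bar> \<le> W2 f h"
  unfolding W2_def
proof (rule cSUP_upper)
  have fL: "f \<in> Linf_T" by (rule C_T_in_Linf_T[OF f])
  have "\<bar>f x - convol f (chi h) x\<bar> \<le> Linf_norm (\<lambda>x. f x - convol f (chi h) x)" for x
    using f by (intro continuous_abs_le_Linf_norm Linf_T_diff fL convol_chi_in_Linf_T[OF h fL]
        continuous_intros convol_chi_continuous[OF h fL]) (simp add: C_T_def)
  then show "bdd_above (range (\<lambda>x. \<bar>f x - convol f (chi h) x\<bar>))"
    by (rule bdd_aboveI2)
qed simp

text \<open>
  After a translation, \<open>x\<close> occurs only in the argument of \<open>\<tau>\<close>, and the function is an average of translates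
  of the reflected \<open>\<tau>\<close>.
\<close>

lemma trig_poly_mean_correlation:
  assumes u: "u \<in> Linf_T" and \<tau>: "\<tau> \<in> trig_poly n"
  shows "(\<lambda>x. mean (\<lambda>t. u (x + t) * \<tau> t)) \<in> trig_poly n"
proof -
  define k where "k t = indicator {-1/2..1/2} t *\<^sub>R u t" for t
  have k: "integrable lebesgue k"
    using Linf_T_integrable_period[OF u] by (simp add: k_def[abs_def] set_integrable_def)
  have \<phi>: "uminus \<in> borel_measurable (lebesgue :: real measure)"
    by (intro borel_imp_lebesgue_measurable) simp
  have "mean (\<lambda>t. u (x + t) * \<tau> t) = (LINT t|lebesgue. k t * \<tau> (- (x + - t)))" for x
  proof -
    have "(\<lambda>t. u t * \<tau> (t + - x)) \<in> Linf_T"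
      by (intro Linf_T_mult u trig_poly_in_Linf_T[OF trig_poly_shift[OF \<tau>]])
    from mean_shift[OF this, of x] show ?thesis
      by (simp add: mean_def set_lebesgue_integral_def k_def mult.assoc)
  qed
  then show ?thesis
    using trig_poly_average[OF k \<phi> trig_poly_reflect[OF \<tau>]] by simp
qed

text \<open>
  With \<open>u = f - \<tau>\<close>, the trigonometric polynomial \<open>\<sigma>\<close> is \<open>\<tau> * \<chi>\<^sub>h\<close> plus the correlation of \<open>u\<close> with \<open>\<tau>0\<close>. It differs from
  \<open>f * \<chi>\<^sub>h\<close> by the correlation of \<open>u\<close> with \<open>periodized_chi h - \<tau>0\<close>, which is at most the product of the supremum norm
  of \<open>u\<close> and the \<open>L\<^sub>1\<close> norm of that difference.
\<close>

lemma best_approx_recursive_bound: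
  assumes h: "h > 0" and f: "f \<in> C_T" and \<tau>: "\<tau> \<in> trig_poly n" and \<tau>0: "\<tau>0 \<in> trig_poly n"
  shows "best_approx n f \<le> W2 f h
    + mean (\<lambda>t. \<bar>periodized_chi h t - \<tau>0 t\<bar>) * Linf_norm (\<lambda>x. f x - \<tau> x)"
proof -
  define u where "u x = f x - \<tau> x" for x
  define \<sigma> where "\<sigma> x = (LINT t|lebesgue. chi h t * \<tau> (x + t)) + mean (\<lambda>t. u (x + t) * \<tau>0 t)" for x
  have fL: "f \<in> Linf_T" by (rule C_T_in_Linf_T[OF f])
  have \<tau>L: "\<tau> \<in> Linf_T" and \<tau>0L: "\<tau>0 \<in> Linf_T" using \<tau> \<tau>0 by (auto intro: trig_poly_in_Linf_T)
  have u: "u \<in> Linf_T" unfolding u_def[abs_def] by (rule Linf_T_diff[OF fL \<tau>L])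
  have w: "periodized_chi h \<in> Linf_T" by (rule periodized_chi_in_Linf_T[OF h])
  have \<sigma>: "\<sigma> \<in> trig_poly n"
    unfolding \<sigma>_def[abs_def]
    by (intro trig_poly_add trig_poly_average integrable_chi \<tau> trig_poly_mean_correlation u \<tau>0)
       (simp add: borel_imp_lebesgue_measurable)
  define D where "D = mean (\<lambda>t. \<bar>periodized_chi h t - \<tau>0 t\<bar>)"
  have convol_near: "\<bar>convol f (chi h) x - \<sigma> x\<bar> \<le> D * Linf_norm u" for x
  proof -
    have shift: "(\<lambda>t. v (x + t)) \<in> Linf_T" if "v \<in> Linf_T" for v
      by (rule Linf_T_shift[OF that])
    have "convol f (chi h) x = (LINT t|lebesgue. u (x + t) * chi h t + chi h t * \<tau> (x + t))"
      by (simp add: convol_chi_eq_shifted_integral u_def algebra_simps)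
    also have "\<dots> = (LINT t|lebesgue. u (x + t) * chi h t) + (LINT t|lebesgue. chi h t * \<tau> (x + t))"
      using Linf_T_integrable_mult[OF shift[OF u] integrable_chi]
        Linf_T_integrable_mult[OF shift[OF \<tau>L] integrable_chi]
      by (intro Bochner_Integration.integral_add) (simp_all add: mult.commute)
    finally have "convol f (chi h) x - \<sigma> x = convol u (chi h) x - mean (\<lambda>t. u (x + t) * \<tau>0 t)"
      by (simp add: \<sigma>_def convol_chi_eq_shifted_integral)
    also have "\<dots> = mean (\<lambda>t. u (x + t) * (periodized_chi h t - \<tau>0 t))"
      unfolding convol_chi_eq_mean[OF h u] right_diff_distrib
      by (intro mean_diff[symmetric] Linf_T_mult shift[OF u] w \<tau>0L)
    finally have diff: "convol f (chi h) x - \<sigma> x = mean (\<lambda>t. u (x + t) * (periodized_chi h t - \<tau>0 t))" .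
    have "\<bar>convol f (chi h) x - \<sigma> x\<bar> \<le> mean (\<lambda>t. \<bar>u (x + t) * (periodized_chi h t - \<tau>0 t)\<bar>)"
      unfolding diff by (intro abs_mean_le Linf_T_mult shift[OF u] Linf_T_diff w \<tau>0L)
    also have "\<dots> \<le> mean (\<lambda>t. Linf_norm u * \<bar>periodized_chi h t - \<tau>0 t\<bar>)"
    proof (rule mean_mono_AE)
      show "AE t in lebesgue. \<bar>u (x + t) * (periodized_chi h t - \<tau>0 t)\<bar>
          \<le> Linf_norm u * \<bar>periodized_chi h t - \<tau>0 t\<bar>"
        using AE_lebesgue_shift[OF Linf_T_AE_le_norm[OF u], of x]
        by eventually_elim (simp add: abs_mult mult_right_mono)
    qed (intro Linf_T_abs Linf_T_mult Linf_T_const shift[OF u] Linf_T_diff w \<tau>0L)+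
    finally show ?thesis by (simp add: mean_cmult D_def mult.commute)
  qed
  have bound: "\<bar>f x - \<sigma> x\<bar> \<le> W2 f h + D * Linf_norm u" for x
    using W2_upper[OF h f, of x] convol_near[of x] by linarith
  have "best_approx n f \<le> Linf_norm (\<lambda>x. f x - \<sigma> x)" by (rule best_approx_le[OF \<sigma>])
  also have "\<dots> \<le> W2 f h + D * Linf_norm u"
    using bound by (intro Linf_norm_le Linf_T_measurable Linf_T_diff fL trig_poly_in_Linf_T[OF \<sigma>]) auto
  finally show ?thesis by (simp add: D_def u_def[abs_def])
qed

theorem theorem2:
  fixes n :: nat and f :: "real \<Rightarrow> real" and h :: real
  assumes "n \<ge> 1"
    and "f \<in> C_T"
    and "h > 1 / (2 * real n)"
  shows "best_approx n f \<le> inverse (1 - c_const h n) * W2 f h"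
proof -
  define E where "E = best_approx n f"
  define c where "c = c_const h n"
  have "0 < 1 / (2 * real n)" using assms(1) by simp
  then have h: "h > 0" using assms(3) by linarith
  have c0: "0 \<le> c" and c1: "c < 1"
    unfolding c_def by (rule c_const_nonneg c_const_less_1; fact assms)+
  have E0: "0 \<le> E" unfolding E_def by (rule best_approx_greatest) (rule Linf_norm_nonneg)
  have step: "E \<le> W2 f h + (c + 2 * \<epsilon>) * E" if \<epsilon>: "\<epsilon> > 0" for \<epsilon>
  proof -
    obtain \<tau>0 where \<tau>0: "\<tau>0 \<in> trig_poly n"
      and close: "mean (\<lambda>t. \<bar>periodized_chi h t - \<tau>0 t\<bar>) \<le> c + 2 * \<epsilon>"
      using periodized_chi_L1_approximation[OF assms(1,3) \<epsilon>] by (auto simp: c_def)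
    have pos: "c + 2 * \<epsilon> > 0" using c0 \<epsilon> by linarith
    \<comment> \<open>The recursive bound is a lower bound on the norm of \<open>f - \<tau>\<close> for every \<open>\<tau>\<close>, hence on the infimum E.\<close>
    have "(E - W2 f h) / (c + 2 * \<epsilon>) \<le> E"
      unfolding E_def
    proof (rule best_approx_greatest)
      fix \<tau> assume \<tau>: "\<tau> \<in> trig_poly n"
      have "best_approx n f \<le> W2 f h + (c + 2 * \<epsilon>) * Linf_norm (\<lambda>x. f x - \<tau> x)"
        using best_approx_recursive_bound[OF h assms(2) \<tau> \<tau>0]
          mult_right_mono[OF close Linf_norm_nonneg[of "\<lambda>x. f x - \<tau> x"]] by linarith
      then show "(best_approx n f - W2 f h) / (c + 2 * \<epsilon>) \<le> Linf_norm (\<lambda>x. f x - \<tau> x)"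
        using pos by (simp add: pos_divide_le_eq mult.commute)
    qed
    then show ?thesis using pos by (simp add: pos_divide_le_eq mult.commute)
  qed
  have "E \<le> W2 f h + c * E"
  proof (rule field_le_epsilon)
    fix e :: real assume e: "0 < e"
    have "E \<le> W2 f h + (c + 2 * (e / (2 * (E + 1)))) * E"
      using e E0 by (intro step) simp
    also have "\<dots> = W2 f h + c * E + e * (E / (E + 1))"
      using E0 by (simp add: field_simps)
    also have "e * (E / (E + 1)) \<le> e * 1"
      using e E0 by (intro mult_left_mono) auto
    finally show "E \<le> W2 f h + c * E + e" by simp
  qed
  then have "E \<le> W2 f h / (1 - c)"
    using c1 by (simp add: pos_le_divide_eq algebra_simps)
  then show ?thesis by (simp add: E_def c_def divide_inverse mult.commute)
qed

end
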